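(* Let $q$ be a prime power, $n\geq 1$ an integer and $0<c\leq 1$. Every $c$-Kakeya set $E\subseteq \mathbb{F}_q(\!(t)\!)^n$ has Hausdorff dimension $n$.
   Context: $K=\mathbb{F}_q(\!(t)\!)$ is the field of formal Laurent series over the finite field $\mathbb{F}_q$ and $A=\mathbb{F}_q[\![t]\!]$ its ring of formal power series. For nonzero $a\in K$, $v_t(a)$ is the least integer $m$ such that the coefficient of $t^m$ in $a$ is nonzero, and $|a|=q^{-v_t(a)}$, $|0|=0$. The space $K^n$ carries the supremum norm $|(a_1,\dots,a_n)|=\max_j|a_j|$ and the metric $d(x,y)=|x-y|$; Hausdorff dimension is taken with respect to this metric. Measure on $K$ (and on subsets of $A$) is the Haar measure normalized so that $A$ has measure $1$. A $c$-Kakeya set is a compact set $E\subseteq K^n$ such that for every $w\in A^n$ there exist a measurable set $J_w\subseteq A$ of measure $\geq c$ and $b_w\in K^n$ with $b_w+J_w w=\{b_w+xw: x\in J_w\}\subseteq E$. *)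

theory Defs
  imports
    "HOL-Analysis.Analysis"
    "HOL-Computational_Algebra.Formal_Laurent_Series"
begin

text \<open>
  The field \<open>\<bbbF>\<^sub>q\<close> is a type \<open>'a :: {field, finite}\<close> with \<open>q = CARD('a)\<close>, the field \<open>K\<close> is
  \<open>'a fls\<close>, and \<open>K\<^sup>n\<close> is \<open>'a fls ^ 'n\<close> with \<open>n = CARD('n)\<close>. The metric that the library puts on
  \<open>'a fls\<close> has base 2 instead of \<open>q\<close>, and the one on \<open>'a fls ^ 'n\<close> is of Euclidean rather than
  supremum type, so the metrics are given explicitly and all topological notions refer to them.
\<close>

subsection \<open>Absolute value and metrics\<close>

definition fls_abs :: "'a::{field,finite} fls \<Rightarrow> real" where
  "fls_abs a = (if a = 0 then 0 else real CARD('a) powi (- fls_subdegree a))"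

definition fls_dist :: "'a::{field,finite} fls \<Rightarrow> 'a fls \<Rightarrow> real" where
  "fls_dist x y = fls_abs (x - y)"

definition fls_integers :: "'a::{field,finite} fls set" where
  "fls_integers = range fps_to_fls"

definition sup_norm :: "'a::{field,finite} fls ^ 'n::finite \<Rightarrow> real" where
  "sup_norm x = Max (range (\<lambda>j. fls_abs (x $ j)))"

definition sup_dist :: "'a::{field,finite} fls ^ 'n::finite \<Rightarrow> 'a fls ^ 'n \<Rightarrow> real" where
  "sup_dist x y = sup_norm (x - y)"

lemma fls_abs_nonneg: "0 \<le> fls_abs a"
  by (simp add: fls_abs_def)

lemma fls_abs_eq_0_iff: "fls_abs a = 0 \<longleftrightarrow> a = 0"
  by (auto simp: fls_abs_def)

lemma fls_abs_minus_commute: "fls_abs (x - y) = fls_abs (y - x)"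
  by (auto simp: fls_abs_def fls_subdegree_minus_sym)

lemma fls_abs_add_le_max:
  fixes a b :: "'a::{field,finite} fls"
  shows "fls_abs (a + b) \<le> max (fls_abs a) (fls_abs b)"
proof (cases "a = 0 \<or> b = 0 \<or> a + b = 0")
  case True
  then show ?thesis
    by (auto simp: fls_abs_def le_max_iff_disj)
next
  case False
  have q: "1 \<le> real CARD('a)"
    by (simp add: Suc_leI)
  have "min (fls_subdegree a) (fls_subdegree b) \<le> fls_subdegree (a + b)"
    using False by (intro fls_plus_subdegree) auto
  then have "- fls_subdegree (a + b) \<le> - fls_subdegree a \<or>
      - fls_subdegree (a + b) \<le> - fls_subdegree b"
    by linarith
  then show ?thesis
    using False power_int_increasing[OF _ q] by (auto simp: fls_abs_def le_max_iff_disj)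
qed

lemma sup_norm_ge: "fls_abs (x $ j) \<le> sup_norm x"
  unfolding sup_norm_def by (rule Max_ge) auto

lemma sup_norm_le_iff: "sup_norm x \<le> r \<longleftrightarrow> (\<forall>j. fls_abs (x $ j) \<le> r)"
  unfolding sup_norm_def by (subst Max_le_iff) auto

lemma Metric_space_fls: "Metric_space UNIV fls_dist"
proof
  fix x y z :: "'a fls"
  show "0 \<le> fls_dist x y"
    by (simp add: fls_dist_def fls_abs_nonneg)
  show "fls_dist x y = fls_dist y x"
    unfolding fls_dist_def by (rule fls_abs_minus_commute)
  show "fls_dist x y = 0 \<longleftrightarrow> x = y"
    by (simp add: fls_dist_def fls_abs_eq_0_iff)
  show "fls_dist x z \<le> fls_dist x y + fls_dist y z"
    using fls_abs_add_le_max[of "x - y" "y - z"] fls_abs_nonneg[of "x - y"]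
      fls_abs_nonneg[of "y - z"] by (simp add: fls_dist_def)
qed

lemma Metric_space_sup: "Metric_space UNIV (sup_dist :: 'a::{field,finite} fls ^ 'n::finite \<Rightarrow> _)"
proof
  fix x y z :: "'a fls ^ 'n"
  show nonneg: "0 \<le> sup_dist x y" for x y :: "'a fls ^ 'n"
    using order_trans[OF fls_abs_nonneg sup_norm_ge] by (simp add: sup_dist_def)
  show "sup_dist x y = sup_dist y x"
    unfolding sup_dist_def sup_norm_def by (simp add: fls_abs_minus_commute)
  have "sup_dist x y \<le> 0 \<longleftrightarrow> x = y"
    by (simp add: sup_dist_def sup_norm_le_iff vec_eq_iff antisym_conv fls_abs_nonneg
        fls_abs_eq_0_iff)
  then show "sup_dist x y = 0 \<longleftrightarrow> x = y"
    using nonneg[of x y] by linarith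
  have "fls_abs ((x - z) $ j) \<le> sup_dist x y + sup_dist y z" for j
    using fls_abs_add_le_max[of "(x - y) $ j" "(y - z) $ j"]
      sup_norm_ge[of "x - y" j] sup_norm_ge[of "y - z" j] nonneg[of x y] nonneg[of y z]
    by (simp add: sup_dist_def)
  then show "sup_dist x z \<le> sup_dist x y + sup_dist y z"
    by (subst sup_dist_def) (simp add: sup_norm_le_iff)
qed

abbreviation fls_topology :: "'a::{field,finite} fls topology" where
  "fls_topology \<equiv> Metric_space.mtopology UNIV fls_dist"

abbreviation sup_topology :: "('a::{field,finite} fls ^ 'n::finite) topology" where
  "sup_topology \<equiv> Metric_space.mtopology UNIV sup_dist"


subsection \<open>Hausdorff measure and dimension\<close>

definition diam :: "('b \<Rightarrow> 'b \<Rightarrow> real) \<Rightarrow> 'b set \<Rightarrow> ennreal" where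
  "diam d U = (SUP x\<in>U. SUP y\<in>U. ennreal (d x y))"

text \<open>
  The value \<open>(diam U)\<^sup>s\<close> with the usual conventions \<open>0\<^sup>0 = 1\<close> for nonempty \<open>U\<close> and
  \<open>(diam \<emptyset>)\<^sup>s = 0\<close>; note that \<open>0 powr 0 = 0\<close>. It is used only for sets of finite diameter.
\<close>

definition diam_power :: "('b \<Rightarrow> 'b \<Rightarrow> real) \<Rightarrow> real \<Rightarrow> 'b set \<Rightarrow> ennreal" where
  "diam_power d s U =
     (if U = {} then 0 else if s = 0 then 1 else ennreal (enn2real (diam d U) powr s))"

definition hausdorff_premeasure ::
    "('b \<Rightarrow> 'b \<Rightarrow> real) \<Rightarrow> real \<Rightarrow> real \<Rightarrow> 'b set \<Rightarrow> ennreal" where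
  "hausdorff_premeasure d \<delta> s E =
     (INF U \<in> {U :: nat \<Rightarrow> 'b set. E \<subseteq> (\<Union>i. U i) \<and> (\<forall>i. diam d (U i) \<le> ennreal \<delta>)}.
        \<Sum>i. diam_power d s (U i))"

definition hausdorff_measure :: "('b \<Rightarrow> 'b \<Rightarrow> real) \<Rightarrow> real \<Rightarrow> 'b set \<Rightarrow> ennreal" where
  "hausdorff_measure d s E = (SUP \<delta>\<in>{0<..}. hausdorff_premeasure d \<delta> s E)"

definition hausdorff_dim :: "('b \<Rightarrow> 'b \<Rightarrow> real) \<Rightarrow> 'b set \<Rightarrow> ennreal" where
  "hausdorff_dim d E = Inf {ennreal s | s. 0 \<le> s \<and> hausdorff_measure d s E = 0}"


subsection \<open>Haar measure and Kakeya sets\<close>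

text \<open>
  These conditions determine the Haar measure on \<open>K\<close>: finiteness on compact sets and regularity
  follow from them, since \<open>K\<close> is separable and locally compact and the ring of power series is a
  compact open subgroup.
\<close>

definition normalized_haar :: "'a::{field,finite} fls measure \<Rightarrow> bool" where
  "normalized_haar \<mu> \<longleftrightarrow>
     space \<mu> = UNIV \<and>
     sets \<mu> = sigma_sets UNIV {U. openin fls_topology U} \<and>
     (\<forall>x. \<forall>B\<in>sets \<mu>. emeasure \<mu> ((\<lambda>y. x + y) ` B) = emeasure \<mu> B) \<and>
     emeasure \<mu> fls_integers = 1"

text \<open>
  Measurability of \<open>J\<close> is with respect to the completed Haar measure, so Borel sets are included.
\<close>

definition kakeya_set ::
    "'a::{field,finite} fls measure \<Rightarrow> real \<Rightarrow> ('a fls ^ 'n::finite) set \<Rightarrow> bool" where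
  "kakeya_set \<mu> c E \<longleftrightarrow>
     compactin sup_topology E \<and>
     (\<forall>w. (\<forall>j. w $ j \<in> fls_integers) \<longrightarrow>
        (\<exists>J b. J \<in> sets (completion \<mu>) \<and> J \<subseteq> fls_integers \<and>
               emeasure (completion \<mu>) J \<ge> ennreal c \<and>
               (\<lambda>x. b + x *s w) ` J \<subseteq> E))"

end

theory Submission
  imports Defs "HOL-Real_Asymp.Real_Asymp"
begin

text \<open>
  Write \<open>q = CARD('a)\<close> and \<open>A = \<bbbF>\<^sub>q[[t]]\<close>. The heart of the proof is a lower bound for a set
  \<open>S\<close> in \<open>(A/t\<^sup>k)\<^sup>n\<close> that contains many points of a line in each of many directions. A torsion
  point of exact level \<open>k\<close> of the Carlitz-type operator \<open>x \<mapsto> x\<^sup>q - a x\<close> on \<open>\<bbbF>\<^sub>q[[X]]\<close> embeds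
  \<open>A/t\<^sup>k\<close> additively into the maximal ideal \<open>(X)\<close>, in such a way that multiplication by \<open>w\<close> is
  given by a polynomial over \<open>\<bbbF>\<^sub>q[[X]]\<close> that reduces to \<open>\<psi>\<^sub>w(Z) = \<Sum>\<^sub>i w\<^sub>i Z\<^bsup>q^i\<^esup>\<close> modulo \<open>X\<close>. If \<open>S\<close>
  is small, some primitive polynomial \<open>P\<close> of low degree vanishes on its image. Its restriction to a
  line in direction \<open>w\<close> has at least \<open>D\<close> zeros in \<open>(X)\<close>, so the reduction \<open>P\<^sub>0\<close> of \<open>P\<close> satisfies
  \<open>Z\<^sup>D dvd P\<^sub>0(\<psi>\<^bsub>w\<^sub>1\<^esub>(Z), \<dots>, \<psi>\<^bsub>w\<^sub>n\<^esub>(Z))\<close>. Lagrange interpolation at the points \<open>\<psi>\<^sub>w\<close>, whose differences have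
  controlled order at \<open>Z = 0\<close>, turns this into a Schwartz-Zippel argument that forces \<open>P\<^sub>0 = 0\<close>.

  The Hausdorff dimension is reduced to this bound by a pigeonhole argument over the scales of a
  finite cover by balls, with weights \<open>1/k\<^sup>2\<close>; dropping the principal parts of Laurent series moves
  all lines into \<open>A\<^sup>n\<close> without increasing the number of balls.
\<close>

unbundle Formal_Power_Series.fps_syntax and Formal_Laurent_Series.fps_syntax

subsection \<open>A Carlitz-type torsion module\<close>

lemma field_power_card: "c ^ CARD('a) = (c :: 'a::{field,finite})"
proof (cases "c = 0")
  case False
  have "(\<Prod>y\<in>UNIV-{0}. c * y) = \<Prod>(UNIV-{0})"
    by (rule prod.reindex_bij_witness[of _ "\<lambda>y. y / c" "\<lambda>y. c * y"]) (use False in auto)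
  then have "c ^ (CARD('a) - 1) = 1"
    by (simp add: prod.distrib)
  moreover have "c ^ CARD('a) = c * c ^ (CARD('a) - 1)"
    by (simp flip: power_Suc)
  ultimately show ?thesis
    by simp
qed simp

lemma card_field_ge_2: "CARD('a::{field,finite}) \<ge> 2"
proof -
  have "card {0, 1::'a} \<le> CARD('a)"
    by (intro card_mono) auto
  then show ?thesis
    by simp
qed

text \<open>\<open>(Z + 1)\<^sup>q - Z\<^sup>q - 1\<close> has degree below \<open>q\<close> and all \<open>q\<close> elements of the field as roots.\<close>
lemma of_nat_card_choose_eq_0:
  assumes "0 < i" "i < CARD('a)"
  shows "of_nat (CARD('a::{field,finite}) choose i) = (0::'a)"
proof -
  let ?q = "CARD('a)"
  define p where "p = (\<Sum>i\<in>{1..<?q}. monom (of_nat (?q choose i) :: 'a) i)"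
  have "poly p c = 0" for c
  proof -
    have "c + 1 = (c + 1) ^ ?q"
      by (simp add: field_power_card)
    also have "\<dots> = (\<Sum>i\<le>?q. of_nat (?q choose i) * c ^ i)"
      by (subst binomial_ring) simp
    also have "{..?q} = insert 0 (insert ?q {1..<?q})"
      by auto
    also have "(\<Sum>i\<in>insert 0 (insert ?q {1..<?q}). of_nat (?q choose i) * c ^ i) = 1 + c + poly p c"
      using card_field_ge_2[where 'a='a]
      by (simp add: field_power_card p_def poly_sum poly_monom add_ac)
    finally show ?thesis
      by simp
  qed
  moreover have "degree p < ?q"
    unfolding p_def by (intro degree_sum_less) (auto intro: le_less_trans[OF degree_monom_le])
  ultimately have "p = 0"
    by (intro poly_eqI_degree[where A = UNIV]) auto
  moreover have "coeff p i = of_nat (?q choose i)"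
    using assms by (simp add: p_def coeff_sum)
  ultimately show ?thesis
    by simp
qed

text \<open>The middle binomial coefficients vanish in the coefficient field, so only the two outer
  terms of the binomial expansion survive. This makes the operator below additive.\<close>

lemma fps_power_card_add:
  fixes x y :: "'a::{field,finite} fps"
  shows "(x + y) ^ CARD('a) = x ^ CARD('a) + y ^ CARD('a)"
proof -
  let ?q = "CARD('a)"
  have *: "of_nat (?q choose i) = (0 :: 'a fps)" if "i \<in> {1..<?q}" for i
    using that of_nat_card_choose_eq_0[of i, where 'a='a] by (simp flip: fps_of_nat)
  have "(x + y) ^ ?q = (\<Sum>i\<le>?q. of_nat (?q choose i) * x ^ i * y ^ (?q - i))"
    by (rule binomial_ring)
  also have "{..?q} = insert 0 (insert ?q {1..<?q})"
    by auto
  also have "(\<Sum>i\<in>insert 0 (insert ?q {1..<?q}). of_nat (?q choose i) * x ^ i * y ^ (?q - i)) =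
      x ^ ?q + y ^ ?q"
    by (simp add: *)
  finally show ?thesis .
qed

text \<open>Models multiplication by t: applied to a torsion point, the iterates of this linear
  operator play the role of the powers of t. If \<open>a\<close> lies in the maximal ideal (X), it
  reduces modulo X to the Frobenius.\<close>

definition carlitz :: "'a::{field,finite} fps \<Rightarrow> 'a fps \<Rightarrow> 'a fps" where
  "carlitz a x = x ^ CARD('a) - a * x"

lemma carlitz_add: "carlitz a (x + y) = carlitz a x + carlitz a y"
  by (simp add: carlitz_def fps_power_card_add algebra_simps)

lemma carlitz_fps_const: "carlitz a (fps_const c * x) = fps_const c * carlitz a x"
  for a :: "'a::{field,finite} fps"
  by (simp add: carlitz_def power_mult_distrib field_power_card fps_const_power algebra_simps)

lemma carlitz_0 [simp]: "carlitz a 0 = 0"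
  by (simp add: carlitz_def)

lemma carlitz_sum: "carlitz a (sum f A) = (\<Sum>i\<in>A. carlitz a (f i))"
  by (induction A rule: infinite_finite_induct) (simp_all add: carlitz_add)

lemma carlitz_pow_sum:
  "(carlitz a ^^ n) (\<Sum>i\<in>A. fps_const (c i) * x i) = (\<Sum>i\<in>A. fps_const (c i) * (carlitz a ^^ n) (x i))"
  by (induction n) (simp_all add: carlitz_sum carlitz_fps_const)

lemma carlitz_pow_0 [simp]: "(carlitz a ^^ n) 0 = 0"
  by (induction n) simp_all

section \<open>X-adic fixed points and torsion points\<close>

lemma fps_X_dvd_iff: "fps_X dvd f \<longleftrightarrow> f $ 0 = 0" for f :: "'a::field fps"
proof (cases "f = 0")
  case False
  then show ?thesis
    by (simp add: fps_dvd_iff subdegree_eq_0_iff Suc_le_eq flip: neq0_conv)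
qed simp

lemma carlitz_pow_nth_0:
  "x $ 0 = 0 \<Longrightarrow> (carlitz a ^^ n) x $ 0 = 0"
proof (induction n)
  case (Suc n)
  then show ?case by (simp add: carlitz_def fps_power_zeroth)
qed simp

lemma fps_X_power_dvd_iff: "fps_X ^ n dvd f \<longleftrightarrow> (\<forall>i<n. f $ i = 0)" for f :: "'a::field fps"
proof (cases "f = 0")
  case False
  then show ?thesis
    by (auto simp: fps_dvd_iff intro: nth_less_subdegree_zero subdegree_geI order_less_le_trans)
qed simp

text \<open>Banach's fixed point theorem for the X-adic metric: successive iterates of 0 agree to
  ever higher order, and their stable coefficients form the fixed point.\<close>

lemma fps_contraction_fixpoint:
  fixes G :: "'a::field fps \<Rightarrow> 'a fps"
  assumes contr: "\<And>x y n. fps_X ^ n dvd x - y \<Longrightarrow> fps_X ^ Suc n dvd G x - G y"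
  obtains a where "G a = a"
proof -
  define s where "s n = (G ^^ n) 0" for n
  have step: "fps_X ^ n dvd s (Suc n) - s n" for n
  proof (induction n)
    case (Suc n)
    then show ?case
      using contr[of n "s (Suc n)" "s n"] by (simp add: s_def)
  qed simp
  have le: "fps_X ^ n dvd s m - s n" if "n \<le> m" for n m
    using that
  proof (induction m rule: dec_induct)
    case (step m)
    have "fps_X ^ n dvd s (Suc m) - s m"
      using dvd_trans[OF le_imp_power_dvd[OF \<open>n \<le> m\<close>] \<open>\<And>n. fps_X ^ n dvd s (Suc n) - s n\<close>[of m]] .
    from dvd_add[OF this step.IH] show ?case
      by simp
  qed simp
  \<comment> \<open>From the iterate \<open>s (Suc n)\<close> on, the coefficient of index
    \<open>n\<close> no longer changes.\<close>
  define a where "a = Abs_fps (\<lambda>n. s (Suc n) $ n)"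
  have a: "fps_X ^ n dvd a - s n" for n
    unfolding fps_X_power_dvd_iff
  proof (intro allI impI)
    fix i assume "i < n"
    then have "fps_X ^ Suc i dvd s n - s (Suc i)"
      by (intro le) simp
    then show "(a - s n) $ i = 0"
      using fps_X_power_dvd_iff[of "Suc i" "s n - s (Suc i)"] by (simp add: a_def del: power_Suc)
  qed
  have "fps_X ^ n dvd G a - a" for n
  proof -
    have "fps_X ^ Suc n dvd G a - s (Suc n)"
      using contr[OF a[of n]] by (simp add: s_def)
    from dvd_diff[OF this a[of "Suc n"]] have "fps_X ^ Suc n dvd G a - a"
      by simp
    then show ?thesis
      using dvd_trans le_imp_power_dvd[of n "Suc n"] by fastforce
  qed
  then have "(G a - a) $ i = 0" for i
    using fps_X_power_dvd_iff[of "Suc i" "G a - a"] by blast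
  then have "G a = a"
    by (auto intro: fps_ext)
  then show ?thesis
    by (rule that)
qed

lemma diff_dvd_power_diff: "x - y dvd x ^ n - y ^ n" for x y :: "'a::comm_ring_1"
  by (simp add: power_diff_sumr2)

text \<open>
  A solution of \<open>a = (T\<^sub>a\<^sup>k X)\<^bsup>q-1\<^esup>\<close>, where \<open>T\<^sub>a\<close> is the Carlitz operator, makes \<open>X\<close> a torsion point
  of exact level \<open>k + 1\<close>, since \<open>T\<^sub>a x = (x\<^bsup>q-1\<^esup> - a) x\<close>.
\<close>
lemma carlitz_torsion:
  obtains a :: "'a::{field,finite} fps"
  where "a $ 0 = 0" "(carlitz a ^^ Suc k) fps_X = 0" "(carlitz a ^^ k) fps_X \<noteq> 0"
proof -
  let ?q = "CARD('a)"
  define G where "G a = ((carlitz a ^^ k) fps_X) ^ (?q - 1)" for a :: "'a fps"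
  \<comment> \<open>The orbit of X depends contractively on the parameter: since every iterate
    \<open>?u\<close> lies in (X), the term \<open>(x - y) * ?u\<close> gains one factor X.\<close>
  have C: "fps_X ^ Suc n dvd (carlitz x ^^ m) fps_X - (carlitz y ^^ m) fps_X"
    if n: "fps_X ^ n dvd x - y" for x y :: "'a fps" and n m
  proof (induction m)
    case (Suc m)
    let ?u = "(carlitz x ^^ m) fps_X" and ?v = "(carlitz y ^^ m) fps_X"
    have "fps_X ^ n * fps_X dvd (x - y) * ?u"
      using n by (intro mult_dvd_mono) (simp_all add: fps_X_dvd_iff carlitz_pow_nth_0)
    moreover have "fps_X ^ n * fps_X dvd ?u ^ ?q - ?v ^ ?q"
      using dvd_trans[OF Suc.IH diff_dvd_power_diff] by (simp add: mult.commute)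
    moreover have "fps_X ^ n * fps_X dvd y * (?u - ?v)"
      using Suc.IH by (simp add: mult.commute)
    ultimately have "fps_X ^ n * fps_X dvd (?u ^ ?q - ?v ^ ?q) - ((x - y) * ?u + y * (?u - ?v))"
      by (metis dvd_add dvd_diff)
    also have "(?u ^ ?q - ?v ^ ?q) - ((x - y) * ?u + y * (?u - ?v)) = carlitz x ?u - carlitz y ?v"
      by (simp add: carlitz_def algebra_simps)
    finally show ?case
      by (simp add: mult.commute)
  qed simp
  obtain a where a: "G a = a"
    by (rule fps_contraction_fixpoint[of G])
      (unfold G_def, rule dvd_trans[OF C diff_dvd_power_diff])
  have q: "?q - 1 > 0"
    using card_field_ge_2[where 'a='a] by simp
  have a0: "a $ 0 = 0"
    using carlitz_pow_nth_0[of fps_X k a] q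
    by (subst a[symmetric]) (simp add: G_def fps_power_zeroth)
  have "(carlitz a ^^ Suc k) fps_X = (G a - a) * (carlitz a ^^ k) fps_X"
    by (simp add: carlitz_def G_def algebra_simps flip: power_Suc)
  then have "(carlitz a ^^ Suc k) fps_X = 0"
    by (simp only: a diff_self mult_zero_left)
  moreover have "(carlitz a ^^ k) fps_X \<noteq> 0"
  proof
    assume *: "(carlitz a ^^ k) fps_X = 0"
    then have "a = 0"
      using a q by (auto simp: G_def power_0_left split: if_splits)
    \<comment> \<open>For parameter 0 the iterates of X are the nonzero powers X^(q^m).\<close>
    have "(carlitz 0 ^^ m) fps_X \<noteq> (0 :: 'a fps)" for m
      by (induction m) (simp_all add: carlitz_def)
    with * \<open>a = 0\<close> show False
      by blast
  qed
  ultimately show ?thesis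
    using that a0 by blast
qed

text \<open>Reduction modulo the maximal ideal of the coefficients. The result is a polynomial in Z,
  stored as a power series so that the order of vanishing at Z = 0 becomes divisibility by
  \<open>fps_X\<close>. From here on \<open>fps_X\<close> denotes Z in reduced objects and X in
  coefficients.\<close>

definition residue_fps :: "'a::comm_ring_1 fps poly \<Rightarrow> 'a fps" where
  "residue_fps p = Abs_fps (\<lambda>i. coeff p i $ 0)"

lemma residue_fps_add: "residue_fps (p + r) = residue_fps p + residue_fps r"
  by (rule fps_ext) (simp add: residue_fps_def)

lemma residue_fps_diff: "residue_fps (p - r) = residue_fps p - residue_fps r"
  by (rule fps_ext) (simp add: residue_fps_def)

lemma residue_fps_mult: "residue_fps (p * r) = residue_fps p * residue_fps r"
  by (rule fps_ext) (simp add: residue_fps_def coeff_mult fps_mult_nth fps_sum_nth atLeast0AtMost)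

lemma residue_fps_pCons: "residue_fps (pCons c p) = fps_const (c $ 0) + fps_X * residue_fps p"
  by (rule fps_ext) (simp add: residue_fps_def coeff_pCons split: nat.split)

lemma residue_fps_0 [simp]: "residue_fps 0 = 0"
  by (rule fps_ext) (simp add: residue_fps_def)

lemma residue_fps_1 [simp]: "residue_fps 1 = 1"
  by (simp add: one_pCons residue_fps_pCons)

lemma residue_fps_smult: "residue_fps (smult c p) = fps_const (c $ 0) * residue_fps p"
  by (rule fps_ext) (simp add: residue_fps_def)

lemma residue_fps_sum: "residue_fps (sum f A) = (\<Sum>i\<in>A. residue_fps (f i))"
  by (induction A rule: infinite_finite_induct) (simp_all add: residue_fps_add)

lemma residue_fps_prod: "residue_fps (prod f A) = (\<Prod>i\<in>A. residue_fps (f i))"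
  by (induction A rule: infinite_finite_induct) (simp_all add: residue_fps_mult)

lemma residue_fps_power: "residue_fps (p ^ n) = residue_fps p ^ n"
  by (induction n) (simp_all add: residue_fps_mult)

text \<open>The polynomial psi_w: modulo X, multiplication by t becomes the Frobenius, so t^i acts
  as Z -> Z^(q^i).\<close>

definition frob_series :: "nat \<Rightarrow> 'a::{field,finite} fps \<Rightarrow> 'a fps" where
  "frob_series k w = (\<Sum>i<k. fps_const (w $ i) * fps_X ^ (CARD('a) ^ i))"

text \<open>
  A model of the module \<open>A/t\<^sup>k\<close> inside the maximal ideal of a power series ring, on which
  multiplication by \<open>w\<close> is a polynomial with a known reduction modulo the maximal ideal.
\<close>
lemma carlitz_module:
  assumes "0 < k"
  obtains \<Psi> :: "'a::{field,finite} fps \<Rightarrow> 'a fps" and L :: "'a fps \<Rightarrow> 'a fps poly"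
  where "\<And>x y. \<Psi> (x + y) = \<Psi> x + \<Psi> y" "\<And>x. \<Psi> x $ 0 = 0"
    "\<And>x y. \<Psi> x = \<Psi> y \<longleftrightarrow> fps_cutoff k x = fps_cutoff k y"
    "\<And>w x. poly (L w) (\<Psi> x) = \<Psi> (w * x)"
    "\<And>w. residue_fps (L w) = frob_series k w"
proof -
  let ?q = "CARD('a)"
  obtain a :: "'a fps" where a: "a $ 0 = 0" "(carlitz a ^^ Suc (k - 1)) fps_X = 0"
    "(carlitz a ^^ (k - 1)) fps_X \<noteq> 0"
    by (rule carlitz_torsion)
  define t where "t i = (carlitz a ^^ i) fps_X" for i
  have carlitz_t: "(carlitz a ^^ m) (t i) = t (m + i)" for m i
    by (simp add: t_def funpow_add)
  have "t k = 0"
    using a(2) assms by (simp add: t_def)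
  then have t_ge: "t i = 0" if "k \<le> i" for i
    using that carlitz_t[of "i - k" k] by simp
  \<comment> \<open>The embedding sends t^i to \<open>t i\<close>, the i-th iterate at the torsion
    point X.\<close>
  define \<Psi> where "\<Psi> x = (\<Sum>i<k. fps_const (x $ i) * t i)" for x :: "'a fps"
  \<comment> \<open>\<open>T i\<close> is the i-th iterate of the operator, written as a polynomial
    in Z.\<close>
  define T where "T i = ((\<lambda>p. p ^ ?q - smult a p) ^^ i) [:0, 1:]" for i
  have poly_T: "poly (T i) z = (carlitz a ^^ i) z" for i z
    by (induction i) (simp_all add: T_def carlitz_def)
  have residue_T: "residue_fps (T i) = fps_X ^ (?q ^ i)" for i
    by (induction i)
      (simp_all add: T_def residue_fps_pCons residue_fps_diff residue_fps_smult
        residue_fps_power a power_mult[symmetric] mult.commute)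
  define L where "L w = (\<Sum>i<k. smult (fps_const (w $ i)) (T i))" for w :: "'a fps"
  have add: "\<Psi> (x + y) = \<Psi> x + \<Psi> y" for x y
    by (simp add: \<Psi>_def sum.distrib distrib_right flip: fps_const_add)
  have diff: "\<Psi> (x - y) = \<Psi> x - \<Psi> y" for x y
    using add[of "x - y" y] by simp
  have nz: "\<Psi> x \<noteq> 0" if "fps_cutoff k x \<noteq> 0" for x
  proof
    assume 0: "\<Psi> x = 0"
    define j where "j = subdegree x"
    have "x \<noteq> 0" and j: "j < k"
      using that by (auto simp: fps_cutoff_zero_iff j_def)
    \<comment> \<open>Applying the operator \<open>k - 1 - j\<close> times moves all terms beyond
      the leading one to level \<open>k\<close> or higher, where \<open>t\<close> vanishes, and the
      leading one to the nonzero \<open>t (k - 1)\<close>.\<close>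
    have "0 = (carlitz a ^^ (k - 1 - j)) (\<Psi> x)"
      by (simp add: 0)
    also have "\<dots> = (\<Sum>i<k. fps_const (x $ i) * t (k - 1 - j + i))"
      by (simp add: \<Psi>_def carlitz_pow_sum carlitz_t)
    also have "\<dots> = (\<Sum>i\<in>{j}. fps_const (x $ i) * t (k - 1 - j + i))"
    proof (rule sum.mono_neutral_right)
      show "\<forall>i\<in>{..<k} - {j}. fps_const (x $ i) * t (k - 1 - j + i) = 0"
      proof
        fix i assume "i \<in> {..<k} - {j}"
        then consider "i < j" | "i > j" by force
        then show "fps_const (x $ i) * t (k - 1 - j + i) = 0"
          by cases (auto simp: j_def t_ge)
      qed
    qed (use j in auto)
    also have "\<dots> = fps_const (x $ j) * t (k - 1)"
      using j by simp
    finally show False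
      using a(3) \<open>x \<noteq> 0\<close> by (simp add: t_def j_def)
  qed
  have "\<Psi> x = \<Psi> y \<longleftrightarrow> fps_cutoff k x = fps_cutoff k y" for x y
  proof
    assume "fps_cutoff k x = fps_cutoff k y"
    then show "\<Psi> x = \<Psi> y"
      by (simp add: \<Psi>_def fps_cutoff_eq_fps_cutoff_iff)
  next
    assume "\<Psi> x = \<Psi> y"
    then show "fps_cutoff k x = fps_cutoff k y"
      using nz[of "x - y"] by (auto simp: diff fps_cutoff_diff)
  qed
  moreover have "\<Psi> x $ 0 = 0" for x
    by (simp add: \<Psi>_def fps_sum_nth t_def carlitz_pow_nth_0)
  moreover have "poly (L w) (\<Psi> x) = \<Psi> (w * x)" for w x
  proof -
    have "poly (L w) (\<Psi> x) = (\<Sum>i<k. \<Sum>l<k. fps_const (w $ i) * (fps_const (x $ l) * t (i + l)))"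
      by (simp add: L_def poly_sum poly_T sum_distrib_left, subst \<Psi>_def)
        (simp add: carlitz_pow_sum carlitz_t sum_distrib_left)
    also have "\<dots> = (\<Sum>(i,l)\<in>{..<k} \<times> {..<k}. fps_const (w $ i * x $ l) * t (i + l))"
      by (simp add: sum.cartesian_product mult.assoc flip: fps_const_mult)
    \<comment> \<open>Since \<open>t (i + l)\<close> vanishes for i + l at least k, only the Cauchy
      product modulo t^k remains.\<close>
    also have "\<dots> = (\<Sum>(i,l)\<in>{(i,l). i + l < k}. fps_const (w $ i * x $ l) * t (i + l))"
      by (rule sum.mono_neutral_right) (auto, meson t_ge not_le)
    also have "\<dots> = (\<Sum>s<k. \<Sum>i\<le>s. fps_const (w $ i * x $ (s - i)) * t s)"
      by (simp add: sum.triangle_reindex)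
    also have "\<dots> = (\<Sum>s<k. fps_const ((w * x) $ s) * t s)"
    proof (intro sum.cong refl)
      fix s
      have "fps_const ((w * x) $ s) = (\<Sum>i\<le>s. fps_const (w $ i * x $ (s - i)))"
        by (rule fps_ext) (simp add: fps_mult_nth fps_sum_nth atLeast0AtMost)
      then show "(\<Sum>i\<le>s. fps_const (w $ i * x $ (s - i)) * t s) = fps_const ((w * x) $ s) * t s"
        by (simp add: sum_distrib_right)
    qed
    also have "\<dots> = \<Psi> (w * x)"
      by (simp add: \<Psi>_def)
    finally show ?thesis .
  qed
  moreover have "residue_fps (L w) = frob_series k w" for w
    by (simp add: L_def residue_fps_sum residue_fps_smult residue_T frob_series_def)
  ultimately show ?thesis
    using that[of \<Psi> L] add by blast
qed


subsection \<open>Polynomials vanishing on a small set\<close>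

text \<open>Gaussian elimination without division. The equation \<open>e\<close> with pivot
  \<open>M e j\<close> removes the unknown \<open>j\<close> from the others by
  cross-multiplication.\<close>

lemma homogeneous_system_nontrivial:
  fixes M :: "'e \<Rightarrow> 'i \<Rightarrow> 'r::idom"
  assumes "finite S" "finite I" "card S < card I"
  shows "\<exists>v. (\<exists>i\<in>I. v i \<noteq> 0) \<and> (\<forall>e\<in>S. (\<Sum>i\<in>I. M e i * v i) = 0)"
  using assms
proof (induction S arbitrary: I M rule: finite_induct)
  case empty
  then have "I \<noteq> {}" by auto
  then show ?case
    by (intro exI[of _ "\<lambda>_. 1"]) auto
next
  case (insert e S)
  show ?case
  proof (cases "\<forall>i\<in>I. M e i = 0")
    case True
    then show ?thesis
      using insert.IH[of I M] insert.prems insert.hyps by auto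
  next
    case False
    then obtain j where j: "j \<in> I" "M e j \<noteq> 0" by auto
    define I' where "I' = I - {j}"
    define M' where "M' f i = M e j * M f i - M f j * M e i" for f i
    have I: "I = insert j I'" "j \<notin> I'" "finite I'"
      using j insert.prems by (auto simp: I'_def)
    have "card S < card I'"
      using insert.prems insert.hyps j by (simp add: I'_def)
    then obtain v' where v': "\<exists>i\<in>I'. v' i \<noteq> 0" "\<forall>f\<in>S. (\<Sum>i\<in>I'. M' f i * v' i) = 0"
      using insert.IH[of I' M'] I by blast
    \<comment> \<open>Scaling the smaller solution by the pivot lets equation \<open>e\<close> be
      solved for the unknown \<open>j\<close> inside the ring.\<close>
    define v where "v = (\<lambda>i. M e j * v' i)(j := - (\<Sum>i\<in>I'. M e i * v' i))"
    have sum_v: "(\<Sum>i\<in>I. M f i * v i) =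
        M e j * (\<Sum>i\<in>I'. M f i * v' i) - M f j * (\<Sum>i\<in>I'. M e i * v' i)" for f
    proof -
      have "(\<Sum>i\<in>I'. M f i * v i) = (\<Sum>i\<in>I'. M e j * (M f i * v' i))"
        using I by (intro sum.cong) (auto simp: v_def)
      then show ?thesis
        using I by (simp add: v_def sum_distrib_left)
    qed
    have "(\<Sum>i\<in>I. M f i * v i) = (\<Sum>i\<in>I'. M' f i * v' i)" for f
      by (simp add: sum_v M'_def left_diff_distrib sum_subtractf sum_distrib_left mult.assoc)
    moreover have "(\<Sum>i\<in>I'. M' e i * v' i) = 0"
      by (simp add: M'_def mult.commute)
    moreover have "\<exists>i\<in>I. v i \<noteq> 0"
    proof -
      obtain i where "i \<in> I'" "v' i \<noteq> 0" using v' by blast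
      then show ?thesis
        using I j by (intro bexI[of _ i]) (auto simp: v_def)
    qed
    ultimately show ?thesis
      using v' by (intro exI[of _ v]) auto
  qed
qed

text \<open>Dividing a solution by the largest power of X common to its entries leaves a solution
  whose reduction modulo X is nonzero.\<close>

lemma homogeneous_system_primitive:
  fixes M :: "'e \<Rightarrow> 'i \<Rightarrow> 'a::field fps"
  assumes "finite S" "finite I" "card S < card I"
  shows "\<exists>v. (\<exists>i\<in>I. v i $ 0 \<noteq> 0) \<and> (\<forall>e\<in>S. (\<Sum>i\<in>I. M e i * v i) = 0)"
proof -
  obtain v where v: "\<exists>i\<in>I. v i \<noteq> 0" "\<forall>e\<in>S. (\<Sum>i\<in>I. M e i * v i) = 0"
    using homogeneous_system_nontrivial[OF assms, of M] by blast
  define I' where "I' = {i\<in>I. v i \<noteq> 0}"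
  define m where "m = Min ((\<lambda>i. subdegree (v i)) ` I')"
  have I': "finite I'" "I' \<noteq> {}"
    using v assms by (auto simp: I'_def)
  have "m \<in> (\<lambda>i. subdegree (v i)) ` I'"
    unfolding m_def using I' by (intro Min_in) auto
  then obtain j where j: "j \<in> I" "v j \<noteq> 0" "subdegree (v j) = m"
    by (auto simp: I'_def)
  have "fps_X ^ m dvd v i" if "i \<in> I" for i
  proof (cases "v i = 0")
    case False
    then have "m \<le> subdegree (v i)"
      unfolding m_def using I' that by (intro Min_le) (auto simp: I'_def)
    then show ?thesis
      using False by (simp add: fps_dvd_iff)
  qed simp
  then obtain u where u: "\<And>i. i \<in> I \<Longrightarrow> v i = fps_X ^ m * u i"
    unfolding dvd_def by metis
  have "u j $ 0 \<noteq> 0"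
    using j u[of j] nth_subdegree_nonzero[of "v j"] by (simp add: fps_X_power_mult_nth)
  moreover have "(\<Sum>i\<in>I. M e i * u i) = 0" if "e \<in> S" for e
  proof -
    have "0 = (\<Sum>i\<in>I. M e i * (fps_X ^ m * u i))"
      using v that u by simp
    also have "\<dots> = fps_X ^ m * (\<Sum>i\<in>I. M e i * u i)"
      by (simp add: sum_distrib_left mult_ac)
    finally show ?thesis
      by simp
  qed
  ultimately show ?thesis
    using j by blast
qed

subsection \<open>Interpolation at the reduced torsion points\<close>

lemma card_le_mult_card_image:
  assumes "finite X" "\<And>y. y \<in> f ` X \<Longrightarrow> card {x\<in>X. f x = y} \<le> c"
  shows "card X \<le> c * card (f ` X)"
proof -
  have "card X = (\<Sum>y\<in>f ` X. card {x\<in>X. f x = y})"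
    using sum.image_gen[OF assms(1), of "\<lambda>_. 1::nat" f] by simp
  also have "\<dots> \<le> (\<Sum>y\<in>f ` X. c)"
    by (intro sum_mono assms)
  finally show ?thesis
    by (simp add: mult.commute)
qed

text \<open>The truncations \<open>range (fps_cutoff k)\<close> serve as representatives of A/t^k
  throughout.\<close>

lemma bij_betw_fps_cutoff:
  "bij_betw (\<lambda>f. restrict (fps_nth f) {..<k}) (range (fps_cutoff k)) ({..<k} \<rightarrow>\<^sub>E (UNIV :: 'a::zero set))"
proof (rule bij_betwI')
  fix x y :: "'a fps"
  assume xy: "x \<in> range (fps_cutoff k)" "y \<in> range (fps_cutoff k)"
  have "x $ i = 0" "y $ i = 0" if "i \<ge> k" for i
    using xy that by auto
  moreover have "x $ i = y $ i" if "restrict (fps_nth x) {..<k} = restrict (fps_nth y) {..<k}" "i < k" for i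
    using fun_cong[OF that(1), of i] that(2) by simp
  ultimately have "x $ i = y $ i" if "restrict (fps_nth x) {..<k} = restrict (fps_nth y) {..<k}" for i
    using that by (cases "i < k") auto
  then show "restrict (fps_nth x) {..<k} = restrict (fps_nth y) {..<k} \<longleftrightarrow> x = y"
    by (auto intro: fps_ext)
next
  fix g assume "g \<in> {..<k} \<rightarrow>\<^sub>E (UNIV :: 'a set)"
  then have "g = restrict (fps_nth (fps_cutoff k (Abs_fps g))) {..<k}"
    by (auto simp: PiE_def extensional_def fun_eq_iff)
  then show "\<exists>x\<in>range (fps_cutoff k). g = restrict (fps_nth x) {..<k}"
    by blast
qed auto

lemma
  shows finite_fps_cutoff [simp]: "finite (range (fps_cutoff k :: 'a::{finite,zero} fps \<Rightarrow> _))"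
    and card_fps_cutoff: "card (range (fps_cutoff k :: 'a::{finite,zero} fps \<Rightarrow> _)) = CARD('a) ^ k"
proof -
  note * = bij_betw_fps_cutoff[of k, where 'a='a]
  have "finite ({..<k} \<rightarrow>\<^sub>E (UNIV :: 'a set))"
    by (intro finite_PiE) auto
  then show "finite (range (fps_cutoff k :: 'a::{finite,zero} fps \<Rightarrow> _))"
    using bij_betw_finite[OF *] by blast
  show "card (range (fps_cutoff k :: 'a::{finite,zero} fps \<Rightarrow> _)) = CARD('a) ^ k"
    using bij_betw_same_card[OF *] by (simp add: card_PiE)
qed

lemma finite_subset_fps_cutoff: "X \<subseteq> range (fps_cutoff k) \<Longrightarrow> finite (X :: 'a::{finite,zero} fps set)"
  by (rule finite_subset) auto

lemma fps_cutoff_fps_cutoff: "fps_cutoff m (fps_cutoff k f) = fps_cutoff (min m k) f"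
  by (rule fps_ext) simp

lemma card_fps_cutoff_fibre:
  fixes X :: "'a::{finite,zero} fps set"
  assumes "X \<subseteq> range (fps_cutoff k)" "m \<le> k" "\<And>x. x \<in> X \<Longrightarrow> fps_cutoff m x = y"
  shows "card X \<le> CARD('a) ^ (k - m)"
proof -
  have "inj_on (fps_shift m) X"
  proof (rule inj_onI, rule fps_ext)
    fix u v i assume *: "u \<in> X" "v \<in> X" "fps_shift m u = fps_shift m v"
    then have "fps_cutoff m u = fps_cutoff m v"
      using assms(3) by metis
    moreover have "u $ (m + (i - m)) = v $ (m + (i - m))"
      using *(3) by (metis fps_shift_nth add.commute)
    ultimately show "u $ i = v $ i"
      by (cases "i < m") (auto simp: fps_cutoff_eq_fps_cutoff_iff)
  qed
  moreover have "fps_shift m ` X \<subseteq> range (fps_cutoff (k - m))"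
  proof
    fix z assume "z \<in> fps_shift m ` X"
    then obtain f where "z = fps_shift m (fps_cutoff k f)"
      using assms(1) by blast
    then have "z = fps_cutoff (k - m) (fps_shift m f)"
      using assms(2) by (auto intro!: fps_ext)
    then show "z \<in> range (fps_cutoff (k - m))"
      by blast
  qed
  ultimately have "card X \<le> card (range (fps_cutoff (k - m) :: 'a fps \<Rightarrow> _))"
    by (intro card_inj_on_le) auto
  then show ?thesis
    by (simp add: card_fps_cutoff)
qed

lemma card_le_card_fps_cutoff_image:
  fixes X :: "'a::{finite,zero} fps set"
  assumes "X \<subseteq> range (fps_cutoff k)" "m \<le> k"
  shows "card X \<le> CARD('a) ^ (k - m) * card (fps_cutoff m ` X)"
proof (rule card_le_mult_card_image)
  show "finite X"
    using assms(1) by (rule finite_subset_fps_cutoff)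
  fix y
  show "card {x \<in> X. fps_cutoff m x = y} \<le> CARD('a) ^ (k - m)"
    using assms by (intro card_fps_cutoff_fibre) auto
qed

section \<open>Orders of vanishing and interpolation\<close>

lemma frob_series_diff: "frob_series k (x - y) = frob_series k x - frob_series k y"
  by (simp add: frob_series_def algebra_simps sum_subtractf flip: fps_const_sub)

text \<open>The exponents q^i increase strictly, so the lowest nonzero coefficient of
  \<open>x\<close> gives the lowest term. Hence the order of psi_x - psi_y at Z = 0 only depends on
  the first coefficient in which x and y differ.\<close>

lemma subdegree_frob_series:
  fixes x :: "'a::{field,finite} fps"
  assumes "fps_cutoff k x \<noteq> 0"
  shows "frob_series k x \<noteq> 0" "subdegree (frob_series k x) = CARD('a) ^ subdegree x"
proof -
  let ?q = "CARD('a)"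
  define j where "j = subdegree x"
  have "x \<noteq> 0" and j: "j < k"
    using assms by (auto simp: fps_cutoff_zero_iff j_def)
  have q: "1 < ?q"
    using card_field_ge_2[where 'a='a] by simp
  have nth: "frob_series k x $ s = (\<Sum>i<k. if s = ?q ^ i then x $ i else 0)" for s
    by (simp add: frob_series_def fps_sum_nth fps_X_power_nth if_distrib cong: if_cong)
  have "frob_series k x $ (?q ^ j) = (\<Sum>i<k. if j = i then x $ i else 0)"
    unfolding nth using q by (intro sum.cong) (auto simp: power_inject_exp)
  also have "\<dots> = x $ j"
    using j by simp
  finally have nz: "frob_series k x $ (?q ^ j) \<noteq> 0"
    using \<open>x \<noteq> 0\<close> by (simp add: j_def)
  have "frob_series k x $ s = 0" if "s < ?q ^ j" for s
    unfolding nth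
  proof (intro sum.neutral ballI)
    fix i assume "i \<in> {..<k}"
    have "x $ i = 0" if "s = ?q ^ i"
    proof -
      have "i < j"
        using \<open>s < ?q ^ j\<close> unfolding that by (rule power_less_imp_less_exp[OF q])
      then show ?thesis
        unfolding j_def by (rule nth_less_subdegree_zero)
    qed
    then show "(if s = ?q ^ i then x $ i else 0) = 0"
      by simp
  qed
  then show "subdegree (frob_series k x) = ?q ^ subdegree x"
    using nz by (simp add: subdegreeI j_def)
  show "frob_series k x \<noteq> 0"
    using nz by auto
qed

text \<open>A class modulo t^r contains at most q^(k-r) truncations, so \<open>G\<close> meets at
  least \<open>d\<close> classes; one element is chosen from each.\<close>

lemma separated_subset:
  fixes G :: "'a::{field,finite} fps set"
  assumes "G \<subseteq> range (fps_cutoff k)" "r \<le> k" "(d - 1) * CARD('a) ^ (k - r) < card G"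
  obtains T where "T \<subseteq> G" "card T = d" "inj_on (fps_cutoff r) T"
proof -
  have "(d - 1) * CARD('a) ^ (k - r) < card (fps_cutoff r ` G) * CARD('a) ^ (k - r)"
    using less_le_trans[OF assms(3) card_le_card_fps_cutoff_image[OF assms(1,2)]]
    by (simp only: mult.commute)
  then have "d \<le> card (fps_cutoff r ` G)"
    by simp
  then obtain Y where "Y \<subseteq> fps_cutoff r ` G" "card Y = d"
    using obtain_subset_with_card_n by metis
  then obtain T where "T \<subseteq> G" "inj_on (fps_cutoff r) T" "Y = fps_cutoff r ` T"
    by (auto simp: subset_image_inj)
  with \<open>card Y = d\<close> show ?thesis
    using that by (auto simp: card_image)
qed

text \<open>The order of the product is the sum of q^ord(x - y). As the points differ modulo t^r, at
  most q^(r-l) of them agree with \<open>x\<close> modulo t^l. Counting level by level, each l < r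
  contributes at most q^(r-l) * q^l = q^r.\<close>

lemma frob_series_vandermonde_dvd:
  fixes T :: "'a::{field,finite} fps set"
  assumes "finite T" "inj_on (fps_cutoff r) T" "r \<le> k" "x \<in> T"
  shows "(\<Prod>y\<in>T - {x}. frob_series k x - frob_series k y) dvd fps_X ^ (r * CARD('a) ^ r)"
proof -
  let ?q = "CARD('a)" and ?T = "T - {x}"
  have "fps_cutoff r y \<noteq> fps_cutoff r x" if "y \<in> ?T" for y
    using that assms by (auto dest: inj_onD)
  then have cut: "fps_cutoff r (x - y) \<noteq> 0" if "y \<in> ?T" for y
    using that by (metis fps_cutoff_diff eq_iff_diff_eq_0)
  then have nz: "x - y \<noteq> 0" and lt: "subdegree (x - y) < r" if "y \<in> ?T" for y
    using cut[OF that] unfolding fps_cutoff_zero_iff by auto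
  have frob: "frob_series k x - frob_series k y \<noteq> 0"
    "subdegree (frob_series k x - frob_series k y) = ?q ^ subdegree (x - y)" if "y \<in> ?T" for y
  proof -
    have "fps_cutoff k (x - y) \<noteq> 0"
      using nz[OF that] lt[OF that] \<open>r \<le> k\<close> unfolding fps_cutoff_zero_iff by auto
    then show "frob_series k x - frob_series k y \<noteq> 0"
      "subdegree (frob_series k x - frob_series k y) = ?q ^ subdegree (x - y)"
      unfolding frob_series_diff[symmetric] by (rule subdegree_frob_series)+
  qed
  have fibre: "card {y\<in>?T. l \<le> subdegree (x - y)} \<le> ?q ^ (r - l)" if "l < r" for l
  proof -
    let ?Y = "{y\<in>?T. l \<le> subdegree (x - y)}"
    have "card ?Y = card (fps_cutoff r ` ?Y)"
      using assms(2) by (intro card_image[symmetric]) (auto intro: inj_on_subset)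
    also have "\<dots> \<le> ?q ^ (r - l)"
    proof (rule card_fps_cutoff_fibre[where y = "fps_cutoff l x"])
      fix z assume "z \<in> fps_cutoff r ` ?Y"
      then obtain y where y: "z = fps_cutoff r y" "l \<le> subdegree (x - y)"
        by blast
      have "fps_cutoff l (x - y) = 0"
        using y by (simp add: fps_cutoff_zero_iff)
      then show "fps_cutoff l z = fps_cutoff l x"
        using \<open>l < r\<close> y by (simp add: fps_cutoff_fps_cutoff fps_cutoff_diff min_def)
    qed (use \<open>l < r\<close> in auto)
    finally show ?thesis .
  qed
  have "subdegree (\<Prod>y\<in>?T. frob_series k x - frob_series k y) = (\<Sum>y\<in>?T. ?q ^ subdegree (x - y))"
    by (subst subdegree_prod[OF frob(1)]) (simp_all only: frob(2) cong: sum.cong)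
  \<comment> \<open>Bounding q^m by the sum of all q^l with l <= m allows the sum to be regrouped by
    levels.\<close>
  also have "\<dots> \<le> (\<Sum>y\<in>?T. \<Sum>l<r. if l \<le> subdegree (x - y) then ?q ^ l else 0)"
  proof (rule sum_mono)
    fix y assume "y \<in> ?T"
    from lt[OF this]
    show "?q ^ subdegree (x - y) \<le> (\<Sum>l<r. if l \<le> subdegree (x - y) then ?q ^ l else 0)"
      using member_le_sum[of "subdegree (x - y)" "{..<r}"
          "\<lambda>l. if l \<le> subdegree (x - y) then ?q ^ l else 0"] by simp
  qed
  also have "\<dots> = (\<Sum>l<r. \<Sum>y\<in>?T. if l \<le> subdegree (x - y) then ?q ^ l else 0)"
    by (rule sum.swap)
  also have "\<dots> = (\<Sum>l<r. card {y\<in>?T. l \<le> subdegree (x - y)} * ?q ^ l)"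
    using assms(1) by (intro sum.cong) (simp_all add: sum.If_cases Int_def conj_commute)
  also have "\<dots> \<le> (\<Sum>l<r. ?q ^ (r - l) * ?q ^ l)"
    by (intro sum_mono mult_right_mono fibre) auto
  also have "\<dots> = r * ?q ^ r"
    by (simp flip: power_add)
  finally show ?thesis
    using frob assms(1) by (simp add: fps_dvd_iff)
qed

text \<open>Lagrange interpolation with cleared denominators: every nodal product divides
  \<open>c\<close>, so \<open>c * p\<close> is a combination of the basis polynomials
  \<open>B z\<close> with coefficients divisible by \<open>c * m\<close>. Cancelling
  \<open>c\<close> gives the claim.\<close>

lemma dvd_coeff_of_dvd_poly:
  fixes p :: "'r::idom poly"
  assumes "finite Z" "degree p < card Z" "c \<noteq> 0"
    and "\<And>z. z \<in> Z \<Longrightarrow> c * m dvd poly p z"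
    and "\<And>z. z \<in> Z \<Longrightarrow> (\<Prod>y\<in>Z - {z}. z - y) dvd c"
  shows "m dvd coeff p i"
proof -
  \<comment> \<open>\<open>e z\<close> is \<open>c\<close> times the Lagrange weight at
    \<open>z\<close>.\<close>
  obtain e where e: "\<And>z. z \<in> Z \<Longrightarrow> c = (\<Prod>y\<in>Z - {z}. z - y) * e z"
    using assms(5) unfolding dvd_def by metis
  define B where "B z = (\<Prod>y\<in>Z - {z}. [:- y, 1:])" for z
  define s where "s = (\<Sum>z\<in>Z. smult (poly p z * e z) (B z))"
  have "card Z > 0"
    using assms by linarith
  have "degree (B z) < card Z" if "z \<in> Z" for z
    using degree_prod_sum_le[of "Z - {z}" "\<lambda>y. [:- y, 1:]"] assms(1) that \<open>card Z > 0\<close>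
    by (auto simp: B_def)
  then have "degree s < card Z"
    unfolding s_def using \<open>card Z > 0\<close>
    by (intro degree_sum_less) (auto intro: le_less_trans[OF degree_smult_le])
  moreover have "poly (smult c p) z = poly s z" if z: "z \<in> Z" for z
  proof -
    have "poly (B w) z = 0" if "w \<in> Z - {z}" for w
      unfolding B_def poly_prod using assms(1) z that by (intro prod_zero) auto
    then have "poly s z = (\<Sum>w\<in>{z}. poly p w * e w * poly (B w) z)"
      unfolding s_def poly_sum poly_smult using assms(1) z by (intro sum.mono_neutral_right) auto
    also have "\<dots> = poly p z * ((\<Prod>y\<in>Z - {z}. z - y) * e z)"
      by (simp add: B_def poly_prod)
    also have "\<dots> = poly p z * c"
      using e[OF z] by simp
    finally show ?thesis
      by simp
  qed
  ultimately have "smult c p = s"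
    using assms by (intro poly_eqI_degree[where A = Z]) auto
  then have "c * coeff p i = coeff s i"
    by (metis coeff_smult)
  also have "c * m dvd coeff s i"
    unfolding s_def coeff_sum coeff_smult by (intro dvd_sum dvd_mult2 assms(4))
  finally show ?thesis
    using \<open>c \<noteq> 0\<close> by simp
qed

text \<open>Induction on the variables. Counting slices shows that more than (d - 1) q^(k-r) values
  of a new coordinate leave a slice large enough for the induction hypothesis. Interpolation at
  \<open>d\<close> such values, distinct modulo t^r, then passes the divisibility on to the
  coefficients. Each coordinate costs r q^r in the order of vanishing.\<close>

lemma schwartz_zippel_frob_series:
  fixes v :: "('n \<Rightarrow> nat) \<Rightarrow> 'a::{field,finite} fps"
  assumes "finite I" "r \<le> k"
    and "W \<subseteq> I \<rightarrow>\<^sub>E range (fps_cutoff k)"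
    and "card I * ((d - 1) * CARD('a) ^ (k - r)) * (CARD('a) ^ k) ^ (card I - 1) < card W"
    and "\<And>w. w \<in> W \<Longrightarrow> fps_X ^ (M + card I * (r * CARD('a) ^ r)) dvd
           (\<Sum>\<alpha>\<in>I \<rightarrow>\<^sub>E {..<d}. v \<alpha> * (\<Prod>j\<in>I. frob_series k (w j) ^ \<alpha> j))"
    and "\<alpha> \<in> I \<rightarrow>\<^sub>E {..<d}"
  shows "fps_X ^ M dvd v \<alpha>"
  using assms(1,3-)
proof (induction I arbitrary: v W M \<alpha> rule: finite_induct)
  case empty
  then obtain w where "w \<in> W"
    by fastforce
  then show ?case
    using empty.prems by auto
next
  case (insert i I)
  let ?R = "range (fps_cutoff k) :: 'a fps set"
  define Q where "Q = CARD('a) ^ k"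
  define h where "h = (d - 1) * CARD('a) ^ (k - r)"
  define C where "C = r * CARD('a) ^ r"
  have cardR: "card ?R = Q"
    by (simp add: Q_def card_fps_cutoff)
  define Wx where "Wx x = {w \<in> I \<rightarrow>\<^sub>E ?R. w(i := x) \<in> W}" for x
  \<comment> \<open>The values of the coordinate \<open>i\<close> whose slice exceeds the bound
    required for \<open>I\<close>.\<close>
  define G where "G = {x\<in>?R. card I * h * Q ^ (card I - 1) < card (Wx x)}"
  have finPi: "finite (I \<rightarrow>\<^sub>E ?R)"
    using insert.hyps by (intro finite_PiE) auto
  have finG: "finite G" and GR: "G \<subseteq> ?R"
    by (auto simp: G_def)
  have W_eq: "W = (\<lambda>(x, w). w(i := x)) ` (SIGMA x:?R. Wx x)"
  proof
    show "W \<subseteq> (\<lambda>(x, w). w(i := x)) ` (SIGMA x:?R. Wx x)"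
    proof
      fix w assume w: "w \<in> W"
      then have "w \<in> (\<lambda>(y, g). g(i := y)) ` (?R \<times> (I \<rightarrow>\<^sub>E ?R))"
        using insert.prems(1) by (auto simp: PiE_insert_eq)
      then show "w \<in> (\<lambda>(x, w). w(i := x)) ` (SIGMA x:?R. Wx x)"
        using w by (auto simp: Wx_def)
    qed
  qed (auto simp: Wx_def)
  have "card W \<le> card (SIGMA x:?R. Wx x)"
    unfolding W_eq using finPi by (intro card_image_le finite_SigmaI) (auto simp: Wx_def)
  also have "\<dots> = (\<Sum>x\<in>?R. card (Wx x))"
    using finPi by (intro card_SigmaI) (auto simp: Wx_def)
  also have "\<dots> = (\<Sum>x\<in>G. card (Wx x)) + (\<Sum>x\<in>?R - G. card (Wx x))"
    using sum.subset_diff[OF GR finite_fps_cutoff] by (simp add: add.commute)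
  also have "\<dots> \<le> (\<Sum>x\<in>G. Q ^ card I) + (\<Sum>x\<in>?R - G. card I * h * Q ^ (card I - 1))"
  proof (intro add_mono sum_mono)
    fix x
    have "card (Wx x) \<le> card (I \<rightarrow>\<^sub>E ?R)"
      using finPi by (intro card_mono) (auto simp: Wx_def)
    then show "card (Wx x) \<le> Q ^ card I"
      using insert.hyps by (simp add: card_funcsetE cardR)
  qed (auto simp: G_def not_less)
  also have "\<dots> \<le> card G * Q ^ card I + Q * (card I * h * Q ^ (card I - 1))"
    using card_mono[of ?R "?R - G"] by (simp add: cardR)
  \<comment> \<open>For empty \<open>I\<close> the truncated exponent is harmless, because the
    factor \<open>card I\<close> is 0.\<close>
  also have "Q * (card I * h * Q ^ (card I - 1)) = card I * h * Q ^ card I"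
    by (cases "card I") (simp_all add: algebra_simps)
  finally have "card W \<le> (card G + card I * h) * Q ^ card I"
    by (simp add: algebra_simps)
  moreover have "(card I * h + h) * Q ^ card I < card W"
    using insert.prems(2)[folded h_def Q_def] insert.hyps by (simp add: algebra_simps)
  ultimately have "(card I * h + h) * Q ^ card I < (card G + card I * h) * Q ^ card I"
    by linarith
  then have "h < card G"
    by simp
  then obtain T where T: "T \<subseteq> G" "card T = d" "inj_on (fps_cutoff r) T"
    using separated_subset[OF GR \<open>r \<le> k\<close>, of d] by (auto simp: h_def)
  have finT: "finite T"
    using T finG finite_subset by blast
  have inj_frob: "inj_on (frob_series k) T"
  proof (rule inj_onI, rule ccontr)
    fix x y assume xy: "x \<in> T" "y \<in> T" "frob_series k x = frob_series k y" "x \<noteq> y"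
    then have "fps_cutoff k x \<noteq> fps_cutoff k y"
      using T GR \<open>r \<le> k\<close> by (metis fps_cutoff_fps_cutoff inj_onD min_def)
    then have "fps_cutoff k (x - y) \<noteq> 0"
      by (simp add: fps_cutoff_diff)
    then show False
      using subdegree_frob_series(1)[of k "x - y"] xy by (simp add: frob_series_diff)
  qed
  obtain \<beta> e where \<alpha>: "\<alpha> = \<beta>(i := e)" "e < d" "\<beta> \<in> I \<rightarrow>\<^sub>E {..<d}"
    using insert.prems(4) by (auto simp: PiE_insert_eq)
  \<comment> \<open>The coefficient of the monomial with exponents \<open>\<beta>\<close> in the old
    variables, as a polynomial in the new one.\<close>
  define p where "p \<beta> = (\<Sum>e<d. monom (v (\<beta>(i := e))) e)" for \<beta>
  have poly_p: "poly (p \<beta>) z = (\<Sum>e<d. v (\<beta>(i := e)) * z ^ e)" for \<beta> z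
    by (simp add: p_def poly_sum poly_monom)
  have dvd: "fps_X ^ (M + C) dvd poly (p \<beta>) (frob_series k x)" if "x \<in> G" for x
  proof (rule insert.IH[where W = "Wx x" and v = "\<lambda>\<beta>. poly (p \<beta>) (frob_series k x)" and \<alpha> = \<beta>])
    show "Wx x \<subseteq> I \<rightarrow>\<^sub>E ?R"
      by (auto simp: Wx_def)
    show "card I * ((d - 1) * CARD('a) ^ (k - r)) * (CARD('a) ^ k) ^ (card I - 1) < card (Wx x)"
      using that by (simp add: G_def h_def Q_def)
    show "\<beta> \<in> I \<rightarrow>\<^sub>E {..<d}"
      by fact
    fix w assume w: "w \<in> Wx x"
    have "(\<Sum>\<alpha>\<in>insert i I \<rightarrow>\<^sub>E {..<d}. v \<alpha> * (\<Prod>j\<in>insert i I. frob_series k ((w(i := x)) j) ^ \<alpha> j))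
      = (\<Sum>(e,\<beta>)\<in>{..<d} \<times> (I \<rightarrow>\<^sub>E {..<d}). v (\<beta>(i := e)) *
          (\<Prod>j\<in>insert i I. frob_series k ((w(i := x)) j) ^ (\<beta>(i := e)) j))"
      unfolding PiE_insert_eq using insert.hyps
      by (subst sum.reindex[OF inj_combinator]) (auto simp: case_prod_unfold)
    also have "\<dots> = (\<Sum>(e,\<beta>)\<in>{..<d} \<times> (I \<rightarrow>\<^sub>E {..<d}). v (\<beta>(i := e)) * frob_series k x ^ e *
          (\<Prod>j\<in>I. frob_series k (w j) ^ \<beta> j))"
    proof (intro sum.cong refl, clarify)
      fix e and \<beta> :: "'n \<Rightarrow> nat"
      have "(\<Prod>j\<in>I. frob_series k ((w(i := x)) j) ^ (\<beta>(i := e)) j) =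
          (\<Prod>j\<in>I. frob_series k (w j) ^ \<beta> j)"
        using insert.hyps by (intro prod.cong) auto
      then show "v (\<beta>(i := e)) * (\<Prod>j\<in>insert i I. frob_series k ((w(i := x)) j) ^ (\<beta>(i := e)) j) =
         v (\<beta>(i := e)) * frob_series k x ^ e * (\<Prod>j\<in>I. frob_series k (w j) ^ \<beta> j)"
        using insert.hyps by (simp add: mult.assoc)
    qed
    also have "\<dots> = (\<Sum>\<beta>\<in>I \<rightarrow>\<^sub>E {..<d}. poly (p \<beta>) (frob_series k x) *
          (\<Prod>j\<in>I. frob_series k (w j) ^ \<beta> j))"
      unfolding sum.cartesian_product[symmetric] poly_p sum_distrib_right by (rule sum.swap)
    finally have sum_eq: "(\<Sum>\<alpha>\<in>insert i I \<rightarrow>\<^sub>E {..<d}.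
        v \<alpha> * (\<Prod>j\<in>insert i I. frob_series k ((w(i := x)) j) ^ \<alpha> j)) = \<dots>" .
    have exp_eq: "M + card (insert i I) * (r * CARD('a) ^ r) = M + C + card I * (r * CARD('a) ^ r)"
      using insert.hyps by (simp add: C_def)
    have "w(i := x) \<in> W"
      using w by (simp add: Wx_def)
    from insert.prems(3)[OF this]
    show "fps_X ^ (M + C + card I * (r * CARD('a) ^ r)) dvd
        (\<Sum>\<beta>\<in>I \<rightarrow>\<^sub>E {..<d}. poly (p \<beta>) (frob_series k x) * (\<Prod>j\<in>I. frob_series k (w j) ^ \<beta> j))"
      unfolding sum_eq exp_eq .
  qed
  have "fps_X ^ M dvd coeff (p \<beta>) e"
  proof (rule dvd_coeff_of_dvd_poly[where Z = "frob_series k ` T" and c = "fps_X ^ C"])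
    have "card (frob_series k ` T) = d"
      using T inj_frob by (simp add: card_image)
    moreover have "degree (p \<beta>) < d"
      unfolding p_def using \<open>e < d\<close>
      by (intro degree_sum_less) (auto intro: le_less_trans[OF degree_monom_le])
    ultimately show "degree (p \<beta>) < card (frob_series k ` T)"
      by simp
    show "fps_X ^ C * fps_X ^ M dvd poly (p \<beta>) z" if "z \<in> frob_series k ` T" for z
      using that dvd T(1) by (auto simp: add.commute simp flip: power_add)
    show "(\<Prod>y\<in>frob_series k ` T - {z}. z - y) dvd fps_X ^ C" if z: "z \<in> frob_series k ` T" for z
    proof -
      from z obtain x where x: "x \<in> T" "z = frob_series k x"
        by blast
      have "frob_series k ` T - {z} = frob_series k ` (T - {x})"
        using x inj_frob by (auto dest: inj_onD)
      moreover have "inj_on (frob_series k) (T - {x})"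
        using inj_frob by (rule inj_on_subset) auto
      ultimately have "(\<Prod>y\<in>frob_series k ` T - {z}. z - y) =
          (\<Prod>y\<in>T - {x}. frob_series k x - frob_series k y)"
        by (simp add: prod.reindex x)
      then show ?thesis
        using frob_series_vandermonde_dvd[OF finT T(3) \<open>r \<le> k\<close> x(1)] by (simp add: C_def)
    qed
  qed (use finT in auto)
  also have "coeff (p \<beta>) e = v \<alpha>"
    using \<alpha> by (simp add: p_def coeff_sum)
  finally show ?case .
qed

subsection \<open>Kakeya sets modulo a power of the uniformizer\<close>

lemma prod_linear_dvd:
  fixes p :: "'r::idom poly"
  assumes "finite Z" "\<And>z. z \<in> Z \<Longrightarrow> poly p z = 0"
  shows "(\<Prod>z\<in>Z. [:- z, 1:]) dvd p"
  using assms
proof (induction Z arbitrary: p rule: finite_induct)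
  case (insert z Z)
  then obtain r where r: "p = [:- z, 1:] * r"
    using poly_eq_0_iff_dvd[of p z] by (auto elim: dvdE)
  have "poly r y = 0" if "y \<in> Z" for y
    using insert.prems[of y] insert.hyps that by (auto simp: r)
  then have "(\<Prod>z\<in>Z. [:- z, 1:]) dvd r"
    by (rule insert.IH)
  then show ?case
    unfolding r prod.insert[OF insert.hyps] by (rule mult_dvd_mono[OF dvd_refl])
qed simp

text \<open>If \<open>S\<close> had fewer than d^n points, some combination of the d^n monomials,
  nonzero modulo X, would vanish on its image. The \<open>D\<close> zeros on each line outweigh the
  interpolation loss of n r q^r, which forces the reduced coefficients to vanish.\<close>

lemma kakeya_mod_power:
  fixes S W :: "('n::finite \<Rightarrow> 'a::{field,finite} fps) set"
  assumes "0 < k" "r \<le> k" "finite S"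
    and W: "W \<subseteq> UNIV \<rightarrow>\<^sub>E range (fps_cutoff k)"
    and cardW: "CARD('n) * ((d - 1) * CARD('a) ^ (k - r)) * (CARD('a) ^ k) ^ (CARD('n) - 1) < card W"
    and D: "CARD('n) * (r * CARD('a) ^ r) < D"
    and lines: "\<And>w. w \<in> W \<Longrightarrow> \<exists>b J. D \<le> card (fps_cutoff k ` J) \<and>
        (\<forall>x\<in>J. (\<lambda>j. fps_cutoff k (b j + x * w j)) \<in> S)"
  shows "d ^ CARD('n) \<le> card S"
proof (rule ccontr)
  assume "\<not> d ^ CARD('n) \<le> card S"
  define A where "A = ((UNIV::'n set) \<rightarrow>\<^sub>E {..<d})"
  have "card A = d ^ CARD('n)" "finite A"
    unfolding A_def by (simp_all add: card_funcsetE finite_PiE)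
  obtain \<Psi> :: "'a fps \<Rightarrow> 'a fps" and L :: "'a fps \<Rightarrow> 'a fps poly"
    where \<Psi>_add: "\<And>x y. \<Psi> (x + y) = \<Psi> x + \<Psi> y" and \<Psi>_0: "\<And>x. \<Psi> x $ 0 = 0"
      and \<Psi>_eq: "\<And>x y. \<Psi> x = \<Psi> y \<longleftrightarrow> fps_cutoff k x = fps_cutoff k y"
      and poly_L: "\<And>w x. poly (L w) (\<Psi> x) = \<Psi> (w * x)"
      and residue_L: "\<And>w. residue_fps (L w) = frob_series k w"
    by (rule carlitz_module[OF \<open>0 < k\<close>]) (rule that)
  have \<Psi>_cutoff: "\<Psi> (fps_cutoff k x) = \<Psi> x" for x
    by (simp add: \<Psi>_eq fps_cutoff_fps_cutoff)
  obtain v :: "('n \<Rightarrow> nat) \<Rightarrow> 'a fps" where v: "\<exists>\<alpha>\<in>A. v \<alpha> $ 0 \<noteq> 0"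
    "\<forall>s\<in>S. (\<Sum>\<alpha>\<in>A. (\<Prod>j\<in>UNIV. \<Psi> (s j) ^ \<alpha> j) * v \<alpha>) = 0"
    using homogeneous_system_primitive[of S A "\<lambda>s \<alpha>. \<Prod>j\<in>UNIV. \<Psi> (s j) ^ \<alpha> j"]
      \<open>finite S\<close> \<open>finite A\<close> \<open>card A = _\<close> \<open>\<not> d ^ CARD('n) \<le> card S\<close> by auto
  \<comment> \<open>The summand 1 is the order that is left after losing r q^r in each
    coordinate.\<close>
  have dvd: "fps_X ^ (1 + CARD('n) * (r * CARD('a) ^ r)) dvd
      (\<Sum>\<alpha>\<in>UNIV \<rightarrow>\<^sub>E {..<d}. fps_const (v \<alpha> $ 0) * (\<Prod>j\<in>UNIV. frob_series k (w j) ^ \<alpha> j))"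
    if w: "w \<in> W" for w
  proof -
    obtain b J where J: "D \<le> card (fps_cutoff k ` J)"
      "\<And>x. x \<in> J \<Longrightarrow> (\<lambda>j. fps_cutoff k (b j + x * w j)) \<in> S"
      using lines[OF w] by blast
    \<comment> \<open>The restriction of the polynomial to the line: multiplication by
      \<open>w j\<close> is realised by \<open>L (w j)\<close>.\<close>
    define f where "f = (\<Sum>\<alpha>\<in>A. smult (v \<alpha>) (\<Prod>j\<in>UNIV. ([:\<Psi> (b j):] + L (w j)) ^ \<alpha> j))"
    have "\<Psi> ` J = \<Psi> ` (fps_cutoff k ` J)"
      by (simp add: image_image \<Psi>_cutoff)
    moreover have "inj_on \<Psi> (fps_cutoff k ` J)"
      by (auto simp: inj_on_def \<Psi>_eq fps_cutoff_fps_cutoff)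
    moreover have "finite (fps_cutoff k ` J)"
      by (rule finite_subset_fps_cutoff) auto
    ultimately have card_J: "D \<le> card (\<Psi> ` J)" "finite (\<Psi> ` J)"
      using J(1) by (simp_all add: card_image)
    have "poly f z = 0" if "z \<in> \<Psi> ` J" for z
    proof -
      from that obtain x where x: "x \<in> J" "z = \<Psi> x"
        by blast
      have "poly f z = (\<Sum>\<alpha>\<in>A. (\<Prod>j\<in>UNIV. \<Psi> (fps_cutoff k (b j + x * w j)) ^ \<alpha> j) * v \<alpha>)"
        by (simp add: f_def poly_sum poly_prod poly_L x \<Psi>_cutoff \<Psi>_add mult.commute)
      then show ?thesis
        using v(2) J(2)[OF x(1)] by simp
    qed
    then have "(\<Prod>z\<in>\<Psi> ` J. [:- z, 1:]) dvd f"
      using card_J by (intro prod_linear_dvd) auto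
    then have "residue_fps (\<Prod>z\<in>\<Psi> ` J. [:- z, 1:]) dvd residue_fps f"
      by (auto elim!: dvdE simp: residue_fps_mult)
    \<comment> \<open>All zeros lie in (X), so every linear factor reduces to Z.\<close>
    moreover have "residue_fps (\<Prod>z\<in>\<Psi> ` J. [:- z, 1:]) = (\<Prod>z\<in>\<Psi> ` J. fps_X)"
      unfolding residue_fps_prod
      by (intro prod.cong) (auto simp: residue_fps_pCons \<Psi>_0)
    ultimately have "fps_X ^ card (\<Psi> ` J) dvd residue_fps f"
      by simp
    moreover have "fps_X ^ (1 + CARD('n) * (r * CARD('a) ^ r)) dvd (fps_X ^ card (\<Psi> ` J) :: 'a fps)"
      by (rule le_imp_power_dvd) (use D card_J in linarith)
    moreover have "residue_fps f =
        (\<Sum>\<alpha>\<in>A. fps_const (v \<alpha> $ 0) * (\<Prod>j\<in>UNIV. frob_series k (w j) ^ \<alpha> j))"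
      by (simp add: f_def residue_fps_sum residue_fps_smult residue_fps_prod residue_fps_power
          residue_fps_add residue_fps_pCons \<Psi>_0 residue_L)
    ultimately show ?thesis
      unfolding A_def by (metis dvd_trans)
  qed
  have "v \<alpha> $ 0 = 0" if "\<alpha> \<in> A" for \<alpha>
  proof -
    \<comment> \<open>The reduced coefficients are constants in Z, so divisibility by Z alone makes
      them zero.\<close>
    have "fps_X ^ 1 dvd fps_const (v \<alpha> $ 0)"
      using schwartz_zippel_frob_series[OF finite_class.finite_UNIV \<open>r \<le> k\<close> W cardW,
          where v = "\<lambda>\<alpha>. fps_const (v \<alpha> $ 0)", OF dvd that[unfolded A_def]] .
    then show ?thesis
      by (simp add: fps_X_dvd_iff)
  qed
  with v(1) show False
    by blast
qed

subsection \<open>Balls, residue classes and Haar measure\<close>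

lemma fls_abs_le_iff:
  fixes a :: "'a::{field,finite} fls"
  shows "fls_abs a \<le> real CARD('a) powi (- m) \<longleftrightarrow> (\<forall>i<m. a $$ i = 0)"
proof (cases "a = 0")
  case False
  have q: "1 < real CARD('a)"
    using card_field_ge_2[where 'a='a] by simp
  have "fls_abs a \<le> real CARD('a) powi (- m) \<longleftrightarrow> m \<le> fls_subdegree a"
  proof
    assume "fls_abs a \<le> real CARD('a) powi (- m)"
    then show "m \<le> fls_subdegree a"
      using power_int_strict_increasing[of "- m" "- fls_subdegree a" "real CARD('a)"] q False
      by (force simp: fls_abs_def)
  next
    assume "m \<le> fls_subdegree a"
    then show "fls_abs a \<le> real CARD('a) powi (- m)"
      using False q by (simp add: fls_abs_def power_int_increasing del: power_int_minus)
  qed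
  also have "\<dots> \<longleftrightarrow> (\<forall>i<m. a $$ i = 0)"
    using False by (auto intro: fls_subdegree_geI)
  finally show ?thesis .
qed (simp add: fls_abs_def)

lemma fls_dist_le_iff:
  fixes x y :: "'a::{field,finite} fls"
  shows "fls_dist x y \<le> real CARD('a) powi (- m) \<longleftrightarrow> (\<forall>i<m. x $$ i = y $$ i)"
  by (simp add: fls_dist_def fls_abs_le_iff)

lemma sup_dist_le_iff:
  fixes x y :: "'a::{field,finite} fls ^ 'n::finite"
  shows "sup_dist x y \<le> real CARD('a) powi (- m) \<longleftrightarrow> (\<forall>j. \<forall>i<m. x $ j $$ i = y $ j $$ i)"
  by (simp add: sup_dist_def sup_norm_le_iff fls_abs_le_iff)

lemma fls_integers_iff: "x \<in> fls_integers \<longleftrightarrow> (\<forall>i<0. x $$ i = 0)"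
proof
  assume "\<forall>i<0. x $$ i = 0"
  then have "x = fps_to_fls (fls_regpart x)"
    by (intro fls_eqI) simp
  then show "x \<in> fls_integers"
    by (auto simp: fls_integers_def)
qed (auto simp: fls_integers_def)

lemma fps_to_fls_regpart: "x \<in> fls_integers \<Longrightarrow> fps_to_fls (fls_regpart x) = x"
  by (auto simp: fls_integers_def)

text \<open>The residue class modulo t^k of an integral series. Any other series first loses its
  principal part; this is additive, and so carries lines with integral direction and parameters to
  lines in A^n.\<close>

definition int_class :: "nat \<Rightarrow> 'a::{field,finite} fls \<Rightarrow> 'a fps" where
  "int_class k x = fps_cutoff k (fls_regpart x)"

lemma int_class_eqI: "(\<And>i. i < int k \<Longrightarrow> x $$ i = y $$ i) \<Longrightarrow> int_class k x = int_class k y"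
  by (simp add: int_class_def fps_cutoff_eq_fps_cutoff_iff)

lemma openin_int_class: "openin fls_topology {x \<in> fls_integers. int_class k x = f}"
proof -
  interpret Metric_space UNIV fls_dist
    by (rule Metric_space_fls)
  show ?thesis
    unfolding openin_mtopology
  proof (intro conjI allI impI subset_UNIV)
    fix x :: "'a fls" assume x: "x \<in> {x \<in> fls_integers. int_class k x = f}"
    let ?r = "real CARD('a) powi (- int k)"
    have "y \<in> {x \<in> fls_integers. int_class k x = f}" if "y \<in> mball x ?r" for y
    proof -
      have "fls_dist x y \<le> ?r"
        using that by simp
      then have *: "\<forall>i<int k. x $$ i = y $$ i"
        unfolding fls_dist_le_iff .
      then have "int_class k y = int_class k x"
        by (intro int_class_eqI) simp
      moreover have "y \<in> fls_integers"
        using x * by (auto simp: fls_integers_iff)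
      ultimately show ?thesis
        using x by simp
    qed
    then show "\<exists>r>0. mball x r \<subseteq> {x \<in> fls_integers. int_class k x = f}"
      by (intro exI[of _ ?r]) (auto simp: zero_less_power_int)
  qed
qed

text \<open>The q^k classes partition A and are translates of each other, so they share the total
  mass 1 equally.\<close>

lemma haar_int_class:
  fixes \<mu> :: "'a::{field,finite} fls measure"
  assumes haar: "normalized_haar \<mu>" and f: "f \<in> range (fps_cutoff k)"
  shows "{x \<in> fls_integers. int_class k x = f} \<in> sets \<mu>"
    and "of_nat (CARD('a) ^ k) * emeasure \<mu> {x \<in> fls_integers. int_class k x = f} = 1"
proof -
  define C where "C f = {x \<in> fls_integers. int_class k x = f}" for f :: "'a fps"
  have sets_C: "C f \<in> sets \<mu>" for f
    using haar openin_int_class[of k f] by (simp add: normalized_haar_def C_def)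
  then show "{x \<in> fls_integers. int_class k x = f} \<in> sets \<mu>"
    by (simp add: C_def)
  have "C g = (\<lambda>y. fps_to_fls g + y) ` C 0" if "g \<in> range (fps_cutoff k)" for g
  proof
    have g: "fps_cutoff k g = g"
      using that by (auto simp: fps_cutoff_fps_cutoff)
    then show "(\<lambda>y. fps_to_fls g + y) ` C 0 \<subseteq> C g"
      by (auto simp: C_def int_class_def fps_cutoff_add fls_integers_iff)
    show "C g \<subseteq> (\<lambda>y. fps_to_fls g + y) ` C 0"
    proof
      fix x assume "x \<in> C g"
      then have "x - fps_to_fls g \<in> C 0"
        using g by (auto simp: C_def int_class_def fps_cutoff_diff fls_integers_iff)
      then show "x \<in> (\<lambda>y. fps_to_fls g + y) ` C 0"
        by (intro image_eqI[of _ _ "x - fps_to_fls g"]) simp_all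
    qed
  qed
  then have trans: "emeasure \<mu> (C g) = emeasure \<mu> (C 0)" if "g \<in> range (fps_cutoff k)" for g
    using haar sets_C that unfolding normalized_haar_def by metis
  have "fls_integers = (\<Union>g\<in>range (fps_cutoff k). C g)"
    by (auto simp: C_def int_class_def)
  then have "1 = emeasure \<mu> (\<Union>g\<in>range (fps_cutoff k). C g)"
    using haar by (simp add: normalized_haar_def)
  also have "\<dots> = (\<Sum>g\<in>range (fps_cutoff k). emeasure \<mu> (C g))"
    by (rule sum_emeasure[symmetric])
      (use sets_C in \<open>auto simp: disjoint_family_on_def C_def\<close>)
  also have "\<dots> = (\<Sum>g\<in>range (fps_cutoff k :: 'a fps \<Rightarrow> _). emeasure \<mu> (C f))"
    using trans f by (intro sum.cong) metis+
  also have "\<dots> = of_nat (CARD('a) ^ k) * emeasure \<mu> (C f)"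
    by (simp add: card_fps_cutoff)
  finally show "of_nat (CARD('a) ^ k) * emeasure \<mu> {x \<in> fls_integers. int_class k x = f} = 1"
    by (simp add: C_def)
qed

text \<open>\<open>J\<close> is covered by the classes that it meets, each of mass q^(-k).\<close>

lemma card_int_class_ge:
  fixes \<mu> :: "'a::{field,finite} fls measure"
  assumes haar: "normalized_haar \<mu>" and J: "J \<in> sets (completion \<mu>)" "J \<subseteq> fls_integers"
    and c: "ennreal c \<le> emeasure (completion \<mu>) J" "0 \<le> c"
  shows "c * real CARD('a) ^ k \<le> card (int_class k ` J)"
proof -
  define F where "F = int_class k ` J"
  define C where "C f = {x \<in> fls_integers. int_class k x = f}" for f :: "'a fps"
  have F: "F \<subseteq> range (fps_cutoff k)"
    by (auto simp: F_def int_class_def)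
  then have finF: "finite F"
    by (rule finite_subset_fps_cutoff)
  have C: "C f \<in> sets \<mu>" "of_nat (CARD('a) ^ k) * emeasure \<mu> (C f) = 1" if "f \<in> F" for f
    using haar_int_class[OF haar, of f k] that F unfolding C_def by auto
  have "J \<subseteq> (\<Union>f\<in>F. C f)"
    using J(2) by (auto simp: F_def C_def)
  moreover have sets_UN: "(\<Union>f\<in>F. C f) \<in> sets \<mu>"
    using C finF by (intro sets.finite_UN) auto
  ultimately have "emeasure (completion \<mu>) J \<le> emeasure (completion \<mu>) (\<Union>f\<in>F. C f)"
    by (intro emeasure_mono sets_completionI_sets)
  also have "\<dots> = emeasure \<mu> (\<Union>f\<in>F. C f)"
    using sets_UN by simp
  also have "\<dots> \<le> (\<Sum>f\<in>F. emeasure \<mu> (C f))"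
    using C finF by (intro emeasure_subadditive_finite) auto
  finally have "ennreal c \<le> (\<Sum>f\<in>F. emeasure \<mu> (C f))"
    using c(1) by (rule order_trans[rotated])
  then have "of_nat (CARD('a) ^ k) * ennreal c \<le> of_nat (CARD('a) ^ k) * (\<Sum>f\<in>F. emeasure \<mu> (C f))"
    by (rule mult_left_mono) simp
  also have "\<dots> = of_nat (card F)"
    using C(2) by (simp add: sum_distrib_left)
  finally have "ennreal (real CARD('a) ^ k * c) \<le> ennreal (real (card F))"
    using c(2) by (simp add: ennreal_mult ennreal_of_nat_eq_real_of_nat ennreal_power)
  then show ?thesis
    by (simp add: F_def mult.commute)
qed

definition sup_ball :: "'a::{field,finite} fls ^ 'n::finite \<Rightarrow> nat \<Rightarrow> ('a fls ^ 'n) set" where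
  "sup_ball x k = {y. sup_dist x y \<le> real CARD('a) powi (- int k)}"

lemma mem_sup_ball_iff: "y \<in> sup_ball x k \<longleftrightarrow> (\<forall>j. \<forall>i<int k. x $ j $$ i = y $ j $$ i)"
  by (simp add: sup_ball_def sup_dist_le_iff)

text \<open>In an ultrametric, closed balls of positive radius are open; compactness can therefore
  be applied to covers by them.\<close>

lemma openin_sup_ball: "openin sup_topology (sup_ball x k)"
  for x :: "'a::{field,finite} fls ^ 'n::finite"
proof -
  interpret Metric_space UNIV "sup_dist :: 'a fls ^ 'n \<Rightarrow> _"
    by (rule Metric_space_sup)
  show ?thesis
    unfolding openin_mtopology
  proof (intro conjI allI impI subset_UNIV)
    fix y assume y: "y \<in> sup_ball x k"
    let ?r = "real CARD('a) powi (- int k)"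
    have "z \<in> sup_ball x k" if "z \<in> mball y ?r" for z
    proof -
      have "z \<in> sup_ball y k"
        using that by (simp add: sup_ball_def)
      then show ?thesis
        using y by (simp add: mem_sup_ball_iff)
    qed
    then show "\<exists>r>0. mball y r \<subseteq> sup_ball x k"
      by (intro exI[of _ ?r]) (auto simp: zero_less_power_int)
  qed
qed

subsection \<open>Hausdorff dimension\<close>

lemma dist_le_diam:
  assumes "x \<in> U" "y \<in> U" "diam d U < \<infinity>"
  shows "d x y \<le> enn2real (diam d U)"
proof -
  have "ennreal (d x y) \<le> diam d U"
    unfolding diam_def using assms by (auto intro: SUP_upper2)
  then show ?thesis
    using assms(3) by (metis enn2real_ennreal enn2real_mono enn2real_nonneg ennreal_neg infinity_ennreal_def
        linorder_linear order_trans)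
qed

text \<open>
  Sets of positive diameter are enlarged to a ball of comparable radius. A set of diameter zero
  gives no bound from below on the size of its ball, so it gets its own scale \<open>k0 + i\<close>.
\<close>
lemma ex_sup_ball_superset:
  fixes U :: "('a::{field,finite} fls ^ 'n::finite) set"
  assumes diam: "diam sup_dist U \<le> ennreal (real CARD('a) powi (- int k0))" and "0 \<le> s"
  shows "\<exists>x k. k0 \<le> k \<and> U \<subseteq> sup_ball x k \<and>
    (k = k0 + i \<or> ennreal (real CARD('a) powr (- (real k + 1) * s)) \<le> diam_power sup_dist s U)"
proof (cases "U = {}")
  case False
  then obtain x where x: "x \<in> U" by blast
  define \<delta> where "\<delta> = enn2real (diam sup_dist U)"
  let ?q = "real CARD('a)"
  have q: "1 < ?q"
    using card_field_ge_2[where 'a='a] by simp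
  have fin: "diam sup_dist U < \<infinity>"
    using diam le_less_trans by fastforce
  have le: "sup_dist x y \<le> \<delta>" if "y \<in> U" for y
    using dist_le_diam[OF x that fin] by (simp add: \<delta>_def)
  have \<delta>_le: "\<delta> \<le> ?q powi (- int k0)"
    using enn2real_mono[OF diam] by (simp add: \<delta>_def)
  show ?thesis
  proof (cases "\<delta> = 0")
    case True
    have "U \<subseteq> sup_ball x (k0 + i)"
      using le True by (force simp: sup_ball_def intro: order_trans)
    then show ?thesis
      by (intro exI[of _ x] exI[of _ "k0 + i"]) simp
  next
    case False
    then have \<delta>: "0 < \<delta>"
      by (simp add: \<delta>_def order_less_le)
    define P where "P n \<longleftrightarrow> ?q powi (- int n) < \<delta>" for n :: nat
    obtain n0 where "(1 / ?q) ^ n0 < \<delta>"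
      using real_arch_pow_inv[OF \<delta>, of "1 / ?q"] q by auto
    then have "P n0"
      by (simp add: P_def power_int_minus power_divide field_simps)
    \<comment> \<open>With \<open>n\<close> least, q^(-n) < delta <= q^(-(n-1)). The ball gets scale
      k = n - 1, whence the exponent k + 1 in the lower bound for the weight.\<close>
    define n where "n = (LEAST n. P n)"
    have "P n"
      unfolding n_def using \<open>P n0\<close> by (rule LeastI)
    have "k0 < n"
    proof (rule ccontr)
      assume "\<not> k0 < n"
      then have "?q powi (- int k0) \<le> ?q powi (- int n)"
        using q by (intro power_int_increasing) auto
      then show False
        using \<delta>_le \<open>P n\<close> by (simp add: P_def)
    qed
    have "\<not> P (n - 1)"
      using not_less_Least[of "n - 1" P] \<open>k0 < n\<close> by (simp add: n_def)
    then have "U \<subseteq> sup_ball x (n - 1)"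
      using le by (force simp: sup_ball_def P_def)
    moreover have "ennreal (?q powr (- (real (n - 1) + 1) * s)) \<le> diam_power sup_dist s U"
    proof (cases "s = 0")
      case False
      have "?q powr (- (real (n - 1) + 1) * s) = (?q powi (- int n)) powr s"
        using \<open>k0 < n\<close> q by (simp add: powr_powr flip: powr_real_of_int')
      also have "\<dots> \<le> \<delta> powr s"
        using \<open>P n\<close> \<open>0 \<le> s\<close> by (intro powr_mono2) (auto simp: P_def)
      finally show ?thesis
        using \<open>U \<noteq> {}\<close> False by (simp add: diam_power_def \<delta>_def ennreal_leI)
    qed (use \<open>U \<noteq> {}\<close> q in \<open>simp add: diam_power_def\<close>)
    ultimately show ?thesis
      using \<open>k0 < n\<close> by (intro exI[of _ x] exI[of _ "n - 1"]) auto
  qed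
qed (auto intro: exI[of _ "k0 + i"])

text \<open>A null set has covers of total weight below 1. A ball of scale k whose weight is at
  least q^(-(k+1)s) can thus occur at most q^((k+1)s) times; the extra 1 allows for the set that was
  given its own scale.\<close>

lemma hausdorff_null_cover:
  fixes E :: "('a::{field,finite} fls ^ 'n::finite) set"
  assumes compact: "compactin sup_topology E" and null: "hausdorff_measure sup_dist s E = 0"
    and "0 \<le> s"
  obtains I :: "nat set" and x \<kappa> where "finite I" "\<And>i. k0 \<le> \<kappa> i" "E \<subseteq> (\<Union>i\<in>I. sup_ball (x i) (\<kappa> i))"
    "\<And>k. real (card {i\<in>I. \<kappa> i = k}) \<le> 1 + real CARD('a) powr ((real k + 1) * s)"
proof -
  let ?q = "real CARD('a)"
  have q: "1 < ?q"
    using card_field_ge_2[where 'a='a] by simp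
  let ?\<delta> = "?q powi (- int k0)"
  have "0 < ?\<delta>"
    using q by (simp add: zero_less_power_int)
  have "hausdorff_premeasure sup_dist ?\<delta> s E \<le> hausdorff_measure sup_dist s E"
    unfolding hausdorff_measure_def using \<open>0 < ?\<delta>\<close> by (intro SUP_upper) simp
  then have "hausdorff_premeasure sup_dist ?\<delta> s E < 1"
    using null by (simp add: le_less_trans[of _ 0])
  then obtain U :: "nat \<Rightarrow> ('a fls ^ 'n) set" where U: "E \<subseteq> (\<Union>i. U i)"
    "\<And>i. diam sup_dist (U i) \<le> ennreal ?\<delta>" "(\<Sum>i. diam_power sup_dist s (U i)) < 1"
    unfolding hausdorff_premeasure_def by (auto simp: INF_less_iff)
  have "\<forall>i. \<exists>x k. k0 \<le> k \<and> U i \<subseteq> sup_ball x k \<and>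
    (k = k0 + i \<or> ennreal (?q powr (- (real k + 1) * s)) \<le> diam_power sup_dist s (U i))"
    using ex_sup_ball_superset[OF U(2) \<open>0 \<le> s\<close>] by blast
  then obtain x \<kappa> where \<kappa>: "\<And>i. k0 \<le> \<kappa> i" "\<And>i. U i \<subseteq> sup_ball (x i) (\<kappa> i)"
    "\<And>i. \<kappa> i = k0 + i \<or> ennreal (?q powr (- (real (\<kappa> i) + 1) * s)) \<le> diam_power sup_dist s (U i)"
    by metis
  have "E \<subseteq> \<Union>(range (\<lambda>i. sup_ball (x i) (\<kappa> i)))"
    using U(1) \<kappa>(2) by blast
  moreover have "\<forall>V\<in>range (\<lambda>i. sup_ball (x i) (\<kappa> i)). openin sup_topology V"
    using openin_sup_ball by blast
  ultimately obtain \<F> where "finite \<F>" "\<F> \<subseteq> range (\<lambda>i. sup_ball (x i) (\<kappa> i))" "E \<subseteq> \<Union>\<F>"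
    using compact unfolding compactin_def by meson
  then obtain I where I: "finite I" "\<F> = (\<lambda>i. sup_ball (x i) (\<kappa> i)) ` I"
    by (meson finite_subset_image subset_UNIV)
  have "real (card {i\<in>I. \<kappa> i = k}) \<le> 1 + ?q powr ((real k + 1) * s)" for k
  proof -
    define B where "B = {i\<in>I. \<kappa> i = k \<and> ennreal (?q powr (- (real k + 1) * s)) \<le> diam_power sup_dist s (U i)}"
    have "finite B"
      using I by (simp add: B_def)
    \<comment> \<open>Only the index \<open>k - k0\<close> can have scale \<open>k\<close> without
      satisfying the weight bound.\<close>
    have "card {i\<in>I. \<kappa> i = k} \<le> card (insert (k - k0) B)"
      using \<kappa>(3) I(1) \<open>finite B\<close> by (intro card_mono) (force simp: B_def)+
    also have "\<dots> \<le> 1 + card B"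
      using \<open>finite B\<close> by (simp add: card_insert_if)
    finally have 1: "card {i\<in>I. \<kappa> i = k} \<le> 1 + card B" .
    have "ennreal (card B * ?q powr (- (real k + 1) * s)) = (\<Sum>i\<in>B. ennreal (?q powr (- (real k + 1) * s)))"
      by (simp add: ennreal_mult ennreal_of_nat_eq_real_of_nat)
    also have "\<dots> \<le> (\<Sum>i\<in>B. diam_power sup_dist s (U i))"
      by (intro sum_mono) (auto simp: B_def)
    also have "\<dots> \<le> (\<Sum>i. diam_power sup_dist s (U i))"
      using \<open>finite B\<close> by (intro sum_le_suminf) auto
    also have "\<dots> \<le> ennreal 1"
      using U(3) by simp
    finally have "card B * ?q powr (- (real k + 1) * s) \<le> 1"
      by (subst (asm) ennreal_le_iff) auto
    moreover have "?q powr (- (real k + 1) * s) = inverse (?q powr ((real k + 1) * s))"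
      by (metis minus_mult_left powr_minus)
    moreover have "0 < ?q powr ((real k + 1) * s)"
      using q by simp
    ultimately have "card B \<le> ?q powr ((real k + 1) * s)"
      by (simp add: divide_inverse[symmetric] divide_le_eq)
    then show ?thesis
      using 1 by linarith
  qed
  moreover have "E \<subseteq> (\<Union>i\<in>I. sup_ball (x i) (\<kappa> i))"
    using I \<open>E \<subseteq> \<Union>\<F>\<close> by blast
  ultimately show ?thesis
    using that[of I \<kappa> x] I(1) \<kappa>(1) by blast
qed

section \<open>Pigeonholing over scales\<close>

lemma sum_inverse_squares_le_1: "(\<Sum>k=2..K. 1 / (real k)\<^sup>2) \<le> 1"
proof (cases "K = 0")
  case False
  then have "0 < K"
    by simp
  then have "(\<Sum>k=2..K. 1 / (real k)\<^sup>2) \<le> 1 - 1 / real K"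
  proof (induction K rule: nat_induct_non_zero)
    case (Suc K)
    have "1 / (real (Suc K))\<^sup>2 \<le> 1 / (real K * real (Suc K))"
      using Suc.hyps by (intro frac_le) (simp_all add: power2_eq_square)
    also have "\<dots> = 1 / real K - 1 / real (Suc K)"
      using Suc.hyps by (simp add: field_simps)
    finally have "1 / (real (Suc K))\<^sup>2 \<le> 1 / real K - 1 / real (Suc K)" .
    then show ?case
      using Suc by simp
  qed simp
  also have "\<dots> \<le> 1"
    by simp
  finally show ?thesis .
qed simp

text \<open>Otherwise the fractions of \<open>X\<close> at the scales would stay below 1/k^2, with
  sum below 1. The loss is polynomial in the chosen scale and independent of \<open>K\<close>, on
  which the cover gives no bound.\<close>

lemma scale_pigeonhole:
  assumes "finite X" "X \<noteq> {}" "X \<subseteq> (\<Union>k\<in>{k0..K}. Y k)" "2 \<le> k0"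
  shows "\<exists>k\<in>{k0..K}. card X \<le> k\<^sup>2 * card (X \<inter> Y k)"
proof (rule ccontr)
  assume neg: "\<not> ?thesis"
  have "{k0..K} \<noteq> {}"
    using assms by auto
  have "real (card X) \<le> real (card (\<Union>k\<in>{k0..K}. X \<inter> Y k))"
    using assms by (intro of_nat_mono card_mono) auto
  also have "\<dots> \<le> (\<Sum>k=k0..K. real (card (X \<inter> Y k)))"
    using card_UN_le[of "{k0..K}" "\<lambda>k. X \<inter> Y k"] by (simp flip: of_nat_sum)
  also have "\<dots> < (\<Sum>k=k0..K. real (card X) * (1 / (real k)\<^sup>2))"
  proof (rule sum_strict_mono)
    fix k assume k: "k \<in> {k0..K}"
    then have "k\<^sup>2 * card (X \<inter> Y k) < card X"
      using neg by force
    then have "(real k)\<^sup>2 * real (card (X \<inter> Y k)) < real (card X)"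
      by (simp flip: of_nat_power of_nat_mult)
    then show "real (card (X \<inter> Y k)) < real (card X) * (1 / (real k)\<^sup>2)"
      using k assms(4) by (simp add: field_simps)
  qed (use \<open>{k0..K} \<noteq> {}\<close> in auto)
  also have "\<dots> \<le> (\<Sum>k=2..K. real (card X) * (1 / (real k)\<^sup>2))"
    using assms(4) by (intro sum_mono2) auto
  also have "\<dots> \<le> real (card X)"
    using mult_left_mono[OF sum_inverse_squares_le_1[of K], of "real (card X)"]
    by (simp add: sum_distrib_left)
  finally show False
    by simp
qed

lemma fps_cutoff_add_mult_cutoff:
  "fps_cutoff k (b + x * fps_cutoff k w) = fps_cutoff k (b + x * (w :: 'a::field fps))"
  by (rule fps_ext) (simp add: fps_cutoff_right_mult_nth)

lemma card_le_card_vec_cutoff_image: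
  fixes X :: "('n::finite \<Rightarrow> 'a::{finite,zero} fps) set"
  assumes "X \<subseteq> UNIV \<rightarrow>\<^sub>E range (fps_cutoff K)" "k \<le> K"
  shows "card X \<le> (CARD('a) ^ (K - k)) ^ CARD('n) * card ((\<lambda>w j. fps_cutoff k (w j)) ` X)"
proof (rule card_le_mult_card_image)
  show "finite X"
    using assms(1) by (rule finite_subset) (intro finite_PiE, auto)
  fix y :: "'n \<Rightarrow> 'a fps"
  have "card {w \<in> X. (\<lambda>j. fps_cutoff k (w j)) = y} \<le>
      card (\<Pi>\<^sub>E j\<in>UNIV. {u \<in> range (fps_cutoff K). fps_cutoff k u = y j})"
    using assms(1) by (intro card_mono finite_PiE) (auto simp: PiE_iff)
  also have "\<dots> = (\<Prod>j\<in>UNIV. card {u \<in> range (fps_cutoff K). fps_cutoff k u = y j})"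
    by (rule card_PiE) simp
  also have "\<dots> \<le> (\<Prod>j\<in>(UNIV::'n set). CARD('a) ^ (K - k))"
    using assms(2) by (intro prod_mono conjI card_fps_cutoff_fibre) auto
  finally show "card {w \<in> X. (\<lambda>j. fps_cutoff k (w j)) = y} \<le> (CARD('a) ^ (K - k)) ^ CARD('n)"
    by simp
qed

text \<open>The three inequalities say that the zeros on a line exceed the interpolation loss, that
  the directions exceed the Schwartz-Zippel bound, and that d^n exceeds the number of balls. With r
  near (1 - a)k and d near q^r / (n k^2), they hold because 1 - a lies strictly between s/n and
  1.\<close>

lemma kakeya_parameters:
  fixes q n :: nat and c s :: real
  assumes "2 \<le> q" "1 \<le> n" "0 < c" "0 \<le> s" "s < real n"
  shows "eventually (\<lambda>k. \<exists>r d. r \<le> k \<and> real (n * (r * q ^ r)) * (real k)\<^sup>2 < c * real q ^ k \<and>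
    n * (d - 1) * k\<^sup>2 < q ^ r \<and> 1 + real q powr ((real k + 1) * s) < real d ^ n) sequentially"
proof -
  define a where "a = (1 - s / n) / 2"
  have a: "0 < a" "a \<le> 1" "1 - a = s / n + a"
    using assms by (auto simp: a_def field_simps)
  have q: "1 < real q" "0 < ln (real q)"
    using assms by auto
  have decay: "eventually (\<lambda>k::nat. B * real k ^ 3 * real q powr (- a * real k) < 1) sequentially" for B
  proof -
    have "((\<lambda>k::nat. B * (real k ^ 3 * exp (- (a * ln q) * real k))) \<longlongrightarrow> B * 0) sequentially"
      by (intro tendsto_mult tendsto_const) (use a q in real_asymp)
    then have "eventually (\<lambda>k::nat. B * (real k ^ 3 * exp (- (a * ln q) * real k)) < 1) sequentially"
      by (rule order_tendstoD(2)) simp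
    then show ?thesis
      using assms by (simp add: powr_def mult_ac)
  qed
  show ?thesis
    \<comment> \<open>In the second constant, q absorbs the rounding of \<open>r\<close>, q^(s/n)
      the shift from k to k + 1, and 2 the summand 1 in the last inequality.\<close>
    using decay[of "n / c"] decay[of "2 * n * q powr (1 + s / n)"] eventually_gt_at_top[of 0]
  proof eventually_elim
    case (elim k)
    define r where "r = nat \<lfloor>(1 - a) * real k\<rfloor>"
    define d where "d = nat \<lceil>real q ^ r / (n * (real k)\<^sup>2)\<rceil>"
    have "0 \<le> (1 - a) * real k" "(1 - a) * real k \<le> real k"
      using a by (auto simp: mult_left_le_one_le)
    then have r: "real r \<le> (1 - a) * real k" "(1 - a) * real k - 1 \<le> real r" "real r \<le> real k"
      by (auto simp: r_def) linarith+
    have q_r: "real q ^ r = real q powr real r"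
      using q by (simp add: powr_realpow)
    have q_k: "real q ^ k = real q powr real k"
      using q by (simp add: powr_realpow)
    have "real (n * (r * q ^ r)) * (real k)\<^sup>2 = real n * (real r * real q powr real r) * (real k)\<^sup>2"
      by (simp add: q_r)
    also have "\<dots> \<le> real n * (real k * real q powr ((1 - a) * real k)) * (real k)\<^sup>2"
      using r q by (intro mult_right_mono mult_left_mono mult_mono powr_mono) auto
    also have "\<dots> = c * real q powr real k * (n / c * real k ^ 3 * real q powr (- a * real k))"
      using assms by (simp add: power2_eq_square power3_eq_cube algebra_simps powr_diff powr_minus divide_inverse)
    also have "\<dots> < c * real q powr real k * 1"
      using elim assms q by (intro mult_strict_left_mono) auto
    finally have 1: "real (n * (r * q ^ r)) * (real k)\<^sup>2 < c * real q ^ k"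
      by (simp add: q_k)
    have pos: "0 < real n * (real k)\<^sup>2"
      using elim assms by simp
    have d_gt: "0 < real q ^ r / (n * (real k)\<^sup>2)"
      using pos q by simp
    then have "real d = real_of_int \<lceil>real q ^ r / (n * (real k)\<^sup>2)\<rceil>"
      by (simp add: d_def)
    then have d: "real d - 1 < real q ^ r / (n * (real k)\<^sup>2)" "real q ^ r / (n * (real k)\<^sup>2) \<le> real d"
      by linarith+
    have "0 < d"
      using d d_gt by (cases d) auto
    then have "real (d - 1) < real q ^ r / (n * (real k)\<^sup>2)"
      using d by (simp add: of_nat_diff)
    then have "real (d - 1) * (n * (real k)\<^sup>2) < real q ^ r"
      using pos by (simp add: pos_less_divide_eq)
    then have "real (n * (d - 1) * k\<^sup>2) < real (q ^ r)"
      by (simp add: mult_ac)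
    then have 2: "n * (d - 1) * k\<^sup>2 < q ^ r"
      by (simp only: of_nat_less_iff)
    have "2 * real n * real q powr (1 + s / n) * (real k)\<^sup>2 * real q powr (- a * real k) \<le>
        2 * real n * real q powr (1 + s / n) * real k ^ 3 * real q powr (- a * real k)"
      using elim by (intro mult_right_mono mult_left_mono power_increasing) auto
    also have "\<dots> < 1"
      using elim by simp
    finally have "2 * real n * (real k)\<^sup>2 * real q powr (1 + s / n - a * real k) < 1"
      by (simp add: powr_add powr_diff powr_minus divide_inverse mult_ac)
    then have "2 * real n * (real k)\<^sup>2 * real q powr (1 + s / n - a * real k) *
        real q powr ((1 - a) * real k - 1) < real q powr ((1 - a) * real k - 1)"
      using q by simp
    moreover have "real q powr (1 + s / n - a * real k) * real q powr ((1 - a) * real k - 1) =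
        real q powr ((real k + 1) * (s / n))"
      unfolding a(3) by (simp add: algebra_simps add_divide_distrib flip: powr_add)
    moreover have "real q powr ((1 - a) * real k - 1) \<le> real q ^ r"
      unfolding q_r using r q by (intro powr_mono) auto
    ultimately have "2 * real n * (real k)\<^sup>2 * real q powr ((real k + 1) * (s / n)) < real q ^ r"
      by (simp add: mult.assoc)
    then have "2 * real q powr ((real k + 1) * (s / n)) < real q ^ r / (n * (real k)\<^sup>2)"
      using pos by (simp add: pos_less_divide_eq mult_ac)
    then have "2 * real q powr ((real k + 1) * (s / n)) < real d"
      using d by linarith
    then have "(2 * real q powr ((real k + 1) * (s / n))) ^ n < real d ^ n"
      using assms by (intro power_strict_mono) auto
    moreover have "(real q powr ((real k + 1) * (s / n))) ^ n = real q powr ((real k + 1) * s)"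
      using q assms by (subst powr_realpow[symmetric]) (auto simp: powr_powr)
    moreover have "(2::real) \<le> 2 ^ n"
      using assms power_increasing[of 1 n "2::real"] by simp
    then have "2 * real q powr ((real k + 1) * s) \<le> 2 ^ n * real q powr ((real k + 1) * s)"
      by (intro mult_right_mono) auto
    moreover have "1 \<le> real q powr ((real k + 1) * s)"
      using q assms by (intro ge_one_powr_ge_zero) auto
    ultimately have 3: "1 + real q powr ((real k + 1) * s) < real d ^ n"
      by (simp add: power_mult_distrib)
    show ?case
      using 1 2 3 r(3) by auto
  qed
qed

text \<open>Two pigeonholes over the scales of a cover: one along each line, giving a scale at which
  many parameter classes hit \<open>S k\<close>, and one over the directions, giving a scale common
  to many of them. There \<open>kakeya_mod_power\<close> contradicts the number of balls.\<close>

lemma kakeya_set_hausdorff_measure_nonzero: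
  fixes \<mu> :: "'a::{field,finite} fls measure" and E :: "('a fls ^ 'n::finite) set"
  assumes haar: "normalized_haar \<mu>" and "0 < c" and kakeya: "kakeya_set \<mu> c E"
    and s: "0 \<le> s" "s < real CARD('n)"
  shows "hausdorff_measure sup_dist s E \<noteq> 0"
proof
  assume null: "hausdorff_measure sup_dist s E = 0"
  let ?q = "CARD('a)" and ?n = "CARD('n)"
  have q: "0 < ?q"
    by simp
  obtain k0 where k0: "2 \<le> k0"
    "\<And>k. k0 \<le> k \<Longrightarrow> \<exists>r d. r \<le> k \<and> real (?n * (r * ?q ^ r)) * (real k)\<^sup>2 < c * real ?q ^ k \<and>
      ?n * (d - 1) * k\<^sup>2 < ?q ^ r \<and> 1 + real ?q powr ((real k + 1) * s) < real d ^ ?n"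
  proof -
    have "eventually (\<lambda>k. \<exists>r d. r \<le> k \<and> real (?n * (r * ?q ^ r)) * (real k)\<^sup>2 < c * real ?q ^ k \<and>
      ?n * (d - 1) * k\<^sup>2 < ?q ^ r \<and> 1 + real ?q powr ((real k + 1) * s) < real d ^ ?n) sequentially"
      by (rule kakeya_parameters) (use card_field_ge_2[where 'a='a] \<open>0 < c\<close> s in \<open>auto simp: Suc_le_eq\<close>)
    then obtain N where "\<And>k. N \<le> k \<Longrightarrow> \<exists>r d. r \<le> k \<and> real (?n * (r * ?q ^ r)) * (real k)\<^sup>2 < c * real ?q ^ k \<and>
      ?n * (d - 1) * k\<^sup>2 < ?q ^ r \<and> 1 + real ?q powr ((real k + 1) * s) < real d ^ ?n"
      unfolding eventually_sequentially by blast
    then show ?thesis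
      using that[of "max 2 N"] by simp
  qed
  obtain I :: "nat set" and x \<kappa> where I: "finite I" "\<And>i. k0 \<le> \<kappa> i"
    "E \<subseteq> (\<Union>i\<in>I. sup_ball (x i) (\<kappa> i))"
    "\<And>k. real (card {i\<in>I. \<kappa> i = k}) \<le> 1 + real ?q powr ((real k + 1) * s)"
    by (rule hausdorff_null_cover[OF conjunct1[OF kakeya[unfolded kakeya_set_def]] null s(1)])
      (rule that)
  \<comment> \<open>A common upper bound for all scales, so that parameters and directions can be
    counted in the finite ring A/t^K.\<close>
  define K where "K = Max (insert k0 (\<kappa> ` I))"
  have K: "\<kappa> i \<in> {k0..K}" if "i \<in> I" for i
    using I that by (auto simp: K_def intro: Max_ge)
  \<comment> \<open>Classes of the centres of the balls of scale \<open>k\<close>; every point of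
    such a ball has its class in \<open>S k\<close>.\<close>
  define S where "S k = (\<lambda>i j. int_class k (x i $ j)) ` {i\<in>I. \<kappa> i = k}" for k
  have finS: "finite (S k)" for k
    using I by (simp add: S_def)
  have cardS: "real (card (S k)) \<le> 1 + real ?q powr ((real k + 1) * s)" for k
  proof -
    have "card (S k) \<le> card {i\<in>I. \<kappa> i = k}"
      unfolding S_def using I by (intro card_image_le) simp
    then show ?thesis
      using I(4)[of k] by linarith
  qed
  have cover: "\<exists>k\<in>{k0..K}. (\<lambda>j. int_class k (e $ j)) \<in> S k" if e: "e \<in> E" for e
  proof -
    obtain i where i: "i \<in> I" "e \<in> sup_ball (x i) (\<kappa> i)"
      using I(3) e by blast
    have "(\<lambda>j. int_class (\<kappa> i) (e $ j)) = (\<lambda>j. int_class (\<kappa> i) (x i $ j))"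
      using i(2) by (intro ext int_class_eqI) (simp add: mem_sup_ball_iff)
    then show ?thesis
      using i K[OF i(1)] by (intro bexI[of _ "\<kappa> i"]) (auto simp: S_def)
  qed
  \<comment> \<open>The line keeps at least a fraction 1/k^2 of the c q^k parameter classes
    guaranteed by the measure.\<close>
  define good where "good k w \<longleftrightarrow> (\<exists>b J. c * real ?q ^ k \<le> real (k\<^sup>2 * card (fps_cutoff k ` J)) \<and>
      (\<forall>x\<in>J. (\<lambda>j. fps_cutoff k (b j + x * w j)) \<in> S k))" for k and w :: "'n \<Rightarrow> 'a fps"
  have ex_good: "\<exists>k\<in>{k0..K}. good k w" for w
  proof -
    define w' :: "'a fls ^ 'n" where "w' = (\<chi> j. fps_to_fls (w j))"
    have "\<forall>j. w' $ j \<in> fls_integers"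
      by (simp add: w'_def fls_integers_def)
    then obtain J b where J: "J \<in> sets (completion \<mu>)" "J \<subseteq> fls_integers"
      "ennreal c \<le> emeasure (completion \<mu>) J" "(\<lambda>x. b + x *s w') ` J \<subseteq> E"
      using kakeya unfolding kakeya_set_def by blast
    define b' where "b' j = fls_regpart (b $ j)" for j
    have line: "int_class k ((b + x *s w') $ j) = fps_cutoff k (b' j + fls_regpart x * w j)"
      if "x \<in> J" for x k j
    proof -
      have "x * fps_to_fls (w j) = fps_to_fls (fls_regpart x * w j)"
        using that J(2) by (auto simp: fls_times_fps_to_fls fps_to_fls_regpart)
      then show ?thesis
        by (simp add: int_class_def w'_def b'_def)
    qed
    define J' where "J' k = {y \<in> fls_regpart ` J. (\<lambda>j. fps_cutoff k (b' j + y * w j)) \<in> S k}" for k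
    define X where "X = fps_cutoff K ` fls_regpart ` J"
    have "X = int_class K ` J"
      by (simp add: X_def int_class_def image_image)
    then have cX: "c * real ?q ^ K \<le> card X"
      using card_int_class_ge[OF haar J(1-3)] \<open>0 < c\<close> by simp
    have finX: "finite X"
      by (rule finite_subset_fps_cutoff[of _ K]) (auto simp: X_def)
    have "0 < c * real ?q ^ K"
      using \<open>0 < c\<close> by simp
    then have "X \<noteq> {}"
      using cX by auto
    moreover have "X \<subseteq> (\<Union>k\<in>{k0..K}. fps_cutoff K ` J' k)"
    proof
      fix y assume "y \<in> X"
      then obtain x where x: "x \<in> J" "y = fps_cutoff K (fls_regpart x)"
        by (auto simp: X_def)
      have "b + x *s w' \<in> E"
        using J(4) x(1) by blast
      then obtain k where "k \<in> {k0..K}" "(\<lambda>j. int_class k ((b + x *s w') $ j)) \<in> S k"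
        using cover by blast
      then show "y \<in> (\<Union>k\<in>{k0..K}. fps_cutoff K ` J' k)"
        using x unfolding line[OF x(1)] by (fastforce simp: J'_def)
    qed
    ultimately obtain k where k: "k \<in> {k0..K}" "card X \<le> k\<^sup>2 * card (X \<inter> fps_cutoff K ` J' k)"
      using scale_pigeonhole[OF finX _ _ k0(1)] by blast
    have "card (X \<inter> fps_cutoff K ` J' k) \<le> card (fps_cutoff K ` J' k)"
      by (intro card_mono finite_subset_fps_cutoff[of _ K]) auto
    \<comment> \<open>A class modulo t^k splits into q^(K-k) classes modulo t^K, which transfers the
      count from level \<open>K\<close> to level \<open>k\<close>.\<close>
    also have "\<dots> \<le> ?q ^ (K - k) * card (fps_cutoff k ` fps_cutoff K ` J' k)"
      using k(1) by (intro card_le_card_fps_cutoff_image) auto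
    also have "fps_cutoff k ` fps_cutoff K ` J' k = fps_cutoff k ` J' k"
      using k(1) by (simp add: image_image fps_cutoff_fps_cutoff min_def)
    finally have "card X \<le> k\<^sup>2 * (?q ^ (K - k) * card (fps_cutoff k ` J' k))"
      using k(2) by (meson le_trans mult_le_mono2)
    then have "real (card X) \<le> real (k\<^sup>2 * card (fps_cutoff k ` J' k)) * real ?q ^ (K - k)"
      by (simp add: mult_ac flip: of_nat_power of_nat_mult)
    moreover have "c * real ?q ^ K = c * real ?q ^ k * real ?q ^ (K - k)"
      using k(1) by (simp flip: power_add)
    ultimately have "c * real ?q ^ k * real ?q ^ (K - k) \<le>
        real (k\<^sup>2 * card (fps_cutoff k ` J' k)) * real ?q ^ (K - k)"
      using cX by linarith
    then have "c * real ?q ^ k \<le> real (k\<^sup>2 * card (fps_cutoff k ` J' k))"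
      by (rule mult_right_le_imp_le) simp
    then have "good k w"
      unfolding good_def by (intro exI[of _ b'] exI[of _ "J' k"]) (auto simp: J'_def)
    then show ?thesis
      using k(1) by blast
  qed
  define \<Omega> :: "('n \<Rightarrow> 'a fps) set" where "\<Omega> = UNIV \<rightarrow>\<^sub>E range (fps_cutoff K)"
  have fin\<Omega>: "finite \<Omega>" and card\<Omega>: "card \<Omega> = (?q ^ K) ^ ?n"
    unfolding \<Omega>_def by (auto intro: finite_PiE simp: card_funcsetE card_fps_cutoff)
  have "\<Omega> \<noteq> {}"
    using card\<Omega> by auto
  then obtain k where k: "k \<in> {k0..K}" "card \<Omega> \<le> k\<^sup>2 * card (\<Omega> \<inter> Collect (good k))"
    using scale_pigeonhole[OF fin\<Omega> _ _ k0(1), where Y = "\<lambda>k. Collect (good k)"] ex_good by blast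
  define W where "W = (\<lambda>w j. fps_cutoff k (w j)) ` (\<Omega> \<inter> Collect (good k))"
  have "(?q ^ K) ^ ?n \<le> k\<^sup>2 * ((?q ^ (K - k)) ^ ?n * card W)"
    using k(1) order_trans[OF k(2) mult_le_mono2[OF card_le_card_vec_cutoff_image[of _ K k]]]
    by (auto simp: \<Omega>_def card\<Omega>[unfolded \<Omega>_def] W_def)
  moreover have "(?q ^ K) ^ ?n = (?q ^ k) ^ ?n * (?q ^ (K - k)) ^ ?n"
    using k(1) by (simp flip: power_add power_mult_distrib)
  ultimately have "(?q ^ k) ^ ?n * (?q ^ (K - k)) ^ ?n \<le> (k\<^sup>2 * card W) * (?q ^ (K - k)) ^ ?n"
    by (simp add: mult_ac)
  then have cardW: "(?q ^ k) ^ ?n \<le> k\<^sup>2 * card W"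
    by simp
  have "k0 \<le> k"
    using k(1) by simp
  then obtain r d where rd: "r \<le> k" "real (?n * (r * ?q ^ r)) * (real k)\<^sup>2 < c * real ?q ^ k"
    "?n * (d - 1) * k\<^sup>2 < ?q ^ r" "1 + real ?q powr ((real k + 1) * s) < real d ^ ?n"
    using k0(2) by blast
  have "0 < k"
    using k0(1) \<open>k0 \<le> k\<close> by simp
  \<comment> \<open>The number of parameter classes that a good direction retains, rounded
    up.\<close>
  define D where "D = nat \<lceil>c * real ?q ^ k / (real k)\<^sup>2\<rceil>"
  have "d ^ ?n \<le> card (S k)"
  proof (rule kakeya_mod_power[OF \<open>0 < k\<close> rd(1) finS, where W = W and D = D])
    show "W \<subseteq> UNIV \<rightarrow>\<^sub>E range (fps_cutoff k)"
      by (auto simp: W_def)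
    have "?n * (d - 1) * k\<^sup>2 * (?q ^ (k - r) * (?q ^ k) ^ (?n - 1)) <
        ?q ^ r * (?q ^ (k - r) * (?q ^ k) ^ (?n - 1))"
      using rd(3) by (intro mult_strict_right_mono) auto
    also have "\<dots> = ?q ^ k * (?q ^ k) ^ (?n - 1)"
      using rd(1) by (simp add: mult.assoc[symmetric] flip: power_add)
    also have "\<dots> = (?q ^ k) ^ ?n"
      by (simp flip: power_Suc)
    also have "\<dots> \<le> k\<^sup>2 * card W"
      by (rule cardW)
    finally have "k\<^sup>2 * (?n * ((d - 1) * ?q ^ (k - r)) * (?q ^ k) ^ (?n - 1)) < k\<^sup>2 * card W"
      by (simp only: mult_ac)
    then show "?n * ((d - 1) * ?q ^ (k - r)) * (?q ^ k) ^ (?n - 1) < card W"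
      by simp
    have "real (?n * (r * ?q ^ r)) < c * real ?q ^ k / (real k)\<^sup>2"
      using rd(2) \<open>0 < k\<close> by (simp add: pos_less_divide_eq)
    then show "?n * (r * ?q ^ r) < D"
      unfolding D_def by linarith
    fix w assume "w \<in> W"
    then obtain w0 where w0: "good k w0" "w = (\<lambda>j. fps_cutoff k (w0 j))"
      by (auto simp: W_def)
    then obtain b J where J: "c * real ?q ^ k \<le> real (k\<^sup>2 * card (fps_cutoff k ` J))"
      "\<forall>x\<in>J. (\<lambda>j. fps_cutoff k (b j + x * w0 j)) \<in> S k"
      unfolding good_def by blast
    have "c * real ?q ^ k / (real k)\<^sup>2 \<le> real (card (fps_cutoff k ` J))"
      using J(1) \<open>0 < k\<close> by (simp add: pos_divide_le_eq mult.commute)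
    then have "D \<le> card (fps_cutoff k ` J)"
      unfolding D_def by linarith
    then show "\<exists>b J. D \<le> card (fps_cutoff k ` J) \<and>
        (\<forall>x\<in>J. (\<lambda>j. fps_cutoff k (b j + x * w j)) \<in> S k)"
      using J(2) by (intro exI[of _ b] exI[of _ J]) (simp add: w0 fps_cutoff_add_mult_cutoff)
  qed
  then have "real d ^ ?n \<le> real (card (S k))"
    by (simp flip: of_nat_power)
  then show False
    using rd(4) cardS[of k] by linarith
qed

section \<open>The upper bound for the dimension\<close>

lemma diam_sup_ball_le:
  fixes x :: "'a::{field,finite} fls ^ 'n::finite"
  shows "diam sup_dist (sup_ball x k) \<le> ennreal (real CARD('a) powi (- int k))"
  unfolding diam_def
proof (intro SUP_least ennreal_leI)
  fix y z assume "y \<in> sup_ball x k" "z \<in> sup_ball x k"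
  then show "sup_dist y z \<le> real CARD('a) powi (- int k)"
    unfolding sup_dist_le_iff mem_sup_ball_iff by simp
qed

text \<open>The finite cover is padded with empty sets, whose \<open>diam_power\<close> is 0 even
  for s = 0.\<close>

lemma hausdorff_premeasure_le_sum:
  assumes "finite P" "E \<subseteq> \<Union>P" "\<And>V. V \<in> P \<Longrightarrow> diam d V \<le> ennreal \<delta>"
  shows "hausdorff_premeasure d \<delta> s E \<le> (\<Sum>V\<in>P. diam_power d s V)"
proof -
  define m where "m = card P"
  obtain h where h: "bij_betw h {0..<m} P"
    using ex_bij_betw_nat_finite[OF assms(1)] unfolding m_def by blast
  have P: "P = h ` {0..<m}"
    using bij_betw_imp_surj_on[OF h] by simp
  define U where "U i = (if i < m then h i else {})" for i
  have "E \<subseteq> (\<Union>i. U i)"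
  proof
    fix e assume "e \<in> E"
    then obtain i where "i < m" "e \<in> h i"
      using assms(2) unfolding P by auto
    then show "e \<in> (\<Union>i. U i)"
      by (intro UN_I[of i]) (simp_all add: U_def)
  qed
  moreover have "diam d (U i) \<le> ennreal \<delta>" for i
    using assms(3)[of "h i"] by (cases "i < m") (simp_all add: U_def P diam_def)
  ultimately have "hausdorff_premeasure d \<delta> s E \<le> (\<Sum>i. diam_power d s (U i))"
    unfolding hausdorff_premeasure_def by (intro INF_lower) simp
  also have "\<dots> = (\<Sum>i\<in>{0..<m}. diam_power d s (U i))"
    by (intro suminf_finite) (simp_all add: U_def diam_power_def)
  also have "\<dots> = (\<Sum>i\<in>{0..<m}. diam_power d s (h i))"
    by (intro sum.cong) (simp_all add: U_def)
  also have "\<dots> = (\<Sum>V\<in>P. diam_power d s V)"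
    by (rule sum.reindex_bij_betw[OF h])
  finally show ?thesis .
qed

text \<open>Finitely many unit balls cover \<open>E\<close>, and each splits into q^(nk) balls of
  radius q^(-k). Their total weight is at most a constant times q^(-(s-n)k), which tends to
  0.\<close>

lemma compact_hausdorff_measure_eq_0:
  fixes E :: "('a::{field,finite} fls ^ 'n::finite) set"
  assumes "compactin sup_topology E" and s: "real CARD('n) < s"
  shows "hausdorff_measure sup_dist s E = 0"
proof -
  let ?q = "real CARD('a)" and ?n = "CARD('n)"
  have q: "1 < ?q"
    using card_field_ge_2[where 'a='a] by simp
  have "\<forall>V\<in>range (\<lambda>x :: 'a fls ^ 'n. sup_ball x 0). openin sup_topology V"
    using openin_sup_ball by blast
  moreover have "E \<subseteq> \<Union>(range (\<lambda>x. sup_ball x 0))"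
    by (auto simp: mem_sup_ball_iff)
  ultimately obtain \<F> where \<F>: "finite \<F>" "\<F> \<subseteq> range (\<lambda>x. sup_ball x 0)" "E \<subseteq> \<Union>\<F>"
    using assms(1) unfolding compactin_def by meson
  then obtain F where F: "finite F" "\<F> = (\<lambda>x. sup_ball x 0) ` F"
    by (meson finite_subset_image)
  have bound: "hausdorff_premeasure sup_dist \<delta> s E \<le> ennreal (card F * ?q powr (- (s - ?n) * real k))"
    if "?q powi (- int k) \<le> \<delta>" for \<delta> k
  proof -
    define \<Omega> :: "('n \<Rightarrow> 'a fps) set" where "\<Omega> = UNIV \<rightarrow>\<^sub>E range (fps_cutoff k)"
    \<comment> \<open>The ball of scale \<open>k\<close> inside the unit ball around
      \<open>x\<close>, its centre moved by the truncated integral vector \<open>w\<close>.\<close>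
    define B where "B = (\<lambda>(x :: 'a fls ^ 'n, w). sup_ball (x + (\<chi> j. fps_to_fls (w j))) k)"
    have fin\<Omega>: "finite \<Omega>" and card\<Omega>: "card \<Omega> = (CARD('a) ^ k) ^ ?n"
      unfolding \<Omega>_def by (auto intro: finite_PiE simp: card_funcsetE card_fps_cutoff)
    have "E \<subseteq> \<Union>(B ` (F \<times> \<Omega>))"
    proof
      fix e assume "e \<in> E"
      then obtain x where x: "x \<in> F" "e \<in> sup_ball x 0"
        using \<F>(3) F by blast
      define w where "w j = int_class k (e $ j - x $ j)" for j
      have "w \<in> \<Omega>"
        by (auto simp: \<Omega>_def w_def int_class_def)
      moreover have "e \<in> B (x, w)"
        using x(2) by (auto simp: B_def mem_sup_ball_iff w_def int_class_def)
      ultimately show "e \<in> \<Union>(B ` (F \<times> \<Omega>))"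
        using x(1) by blast
    qed
    moreover have diam: "diam sup_dist V \<le> ennreal (?q powi (- int k))" if "V \<in> B ` (F \<times> \<Omega>)" for V
      using that diam_sup_ball_le by (auto simp: B_def)
    moreover have "ennreal (?q powi (- int k)) \<le> ennreal \<delta>"
      using \<open>?q powi (- int k) \<le> \<delta>\<close> by (rule ennreal_leI)
    ultimately have "hausdorff_premeasure sup_dist \<delta> s E \<le> (\<Sum>V\<in>B ` (F \<times> \<Omega>). diam_power sup_dist s V)"
      using F(1) fin\<Omega> by (intro hausdorff_premeasure_le_sum) (blast intro: order_trans)+
    also have "\<dots> \<le> (\<Sum>V\<in>B ` (F \<times> \<Omega>). ennreal (?q powr (- s * real k)))"
    proof (rule sum_mono)
      fix V assume "V \<in> B ` (F \<times> \<Omega>)"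
      from enn2real_mono[OF diam[OF this]] have "enn2real (diam sup_dist V) \<le> ?q powr (- real k)"
        using q by (simp flip: powr_real_of_int')
      then have "enn2real (diam sup_dist V) powr s \<le> (?q powr (- real k)) powr s"
        using s by (intro powr_mono2) auto
      then show "diam_power sup_dist s V \<le> ennreal (?q powr (- s * real k))"
        using s by (auto simp: diam_power_def powr_powr mult.commute intro: ennreal_leI)
    qed
    also have "\<dots> = ennreal (card (B ` (F \<times> \<Omega>)) * ?q powr (- s * real k))"
      by (simp add: ennreal_mult ennreal_of_nat_eq_real_of_nat)
    also have "\<dots> \<le> ennreal (card F * (?q powr (?n * real k)) * ?q powr (- s * real k))"
    proof (intro ennreal_leI mult_right_mono)
      have "card (B ` (F \<times> \<Omega>)) \<le> card F * card \<Omega>"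
        using card_image_le[of "F \<times> \<Omega>" B] F fin\<Omega> by (simp add: card_cartesian_product)
      then have "real (card (B ` (F \<times> \<Omega>))) \<le> real (card F) * (?q ^ k) ^ ?n"
        by (simp add: card\<Omega> flip: of_nat_power of_nat_mult)
      also have "(?q ^ k) ^ ?n = ?q powr (?n * real k)"
        using q by (simp add: powr_realpow[symmetric] powr_powr mult.commute)
      finally show "real (card (B ` (F \<times> \<Omega>))) \<le> card F * ?q powr (?n * real k)" .
    qed simp
    also have "card F * (?q powr (?n * real k)) * ?q powr (- s * real k) =
        card F * ?q powr (- (s - ?n) * real k)"
      by (simp add: algebra_simps flip: powr_add)
    finally show ?thesis .
  qed
  have "hausdorff_premeasure sup_dist \<delta> s E \<le> 0" if "0 < \<delta>" for \<delta>
  proof (rule tendsto_lowerbound)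
    have "(\<lambda>k::nat. card F * ?q powr (- (s - ?n) * real k)) \<longlonglongrightarrow> 0"
    proof -
      define a where "a = (s - ?n) * ln ?q"
      have "a > 0"
        using s q by (simp add: a_def)
      then have "(\<lambda>k::nat. exp (- a * real k)) \<longlonglongrightarrow> 0"
        by real_asymp
      then have "(\<lambda>k::nat. card F * exp (- a * real k)) \<longlonglongrightarrow> real (card F) * 0"
        by (intro tendsto_mult tendsto_const)
      moreover have "exp (- a * real k) = ?q powr (- (s - ?n) * real k)" for k
        using q by (simp add: powr_def a_def algebra_simps)
      ultimately show ?thesis
        by simp
    qed
    then show "(\<lambda>k::nat. ennreal (card F * ?q powr (- (s - ?n) * real k))) \<longlonglongrightarrow> 0"
      by (metis ennreal_0 tendsto_ennrealI)
    have "(\<lambda>k. (1 / ?q) ^ k) \<longlonglongrightarrow> 0"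
      using q by (intro LIMSEQ_power_zero) simp
    then have "eventually (\<lambda>k. (1 / ?q) ^ k < \<delta>) sequentially"
      using that by (rule order_tendstoD)
    then show "eventually (\<lambda>k. hausdorff_premeasure sup_dist \<delta> s E \<le>
        ennreal (card F * ?q powr (- (s - ?n) * real k))) sequentially"
    proof eventually_elim
      case (elim k)
      then show ?case
        by (intro bound) (simp add: power_int_minus power_divide inverse_eq_divide)
    qed
  qed simp
  then have "hausdorff_measure sup_dist s E \<le> 0"
    unfolding hausdorff_measure_def by (intro SUP_least) simp
  then show ?thesis
    by simp
qed

theorem theorem1p1:
  fixes \<mu> :: "'a::{field,finite} fls measure"
    and c :: real
    and E :: "('a fls ^ 'n::finite) set"
  assumes "normalized_haar \<mu>"
    and "0 < c" and "c \<le> 1"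
    and "kakeya_set \<mu> c E"
  shows "hausdorff_dim sup_dist E = of_nat CARD('n)"
proof (rule antisym)
  have compact: "compactin sup_topology E"
    using assms(4) by (simp add: kakeya_set_def)
  show "hausdorff_dim sup_dist E \<le> of_nat CARD('n)"
  \<comment> \<open>Nullity is available for exponents above n, so n is approached from the
    right.\<close>
  proof (rule ennreal_le_epsilon)
    fix e :: real assume "0 < e"
    then have "hausdorff_dim sup_dist E \<le> ennreal (real CARD('n) + e)"
      unfolding hausdorff_dim_def
      using compact_hausdorff_measure_eq_0[OF compact, of "real CARD('n) + e"]
      by (intro Inf_lower CollectI exI[of _ "real CARD('n) + e"] conjI refl) simp_all
    then show "hausdorff_dim sup_dist E \<le> of_nat CARD('n) + ennreal e"
      using \<open>0 < e\<close> by (simp add: ennreal_plus ennreal_of_nat_eq_real_of_nat)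
  qed
  show "of_nat CARD('n) \<le> hausdorff_dim sup_dist E"
    unfolding hausdorff_dim_def
  proof (rule Inf_greatest)
    fix z assume "z \<in> {ennreal s |s. 0 \<le> s \<and> hausdorff_measure sup_dist s E = 0}"
    then obtain s where s: "z = ennreal s" "0 \<le> s" "hausdorff_measure sup_dist s E = 0"
      by blast
    then have "real CARD('n) \<le> s"
      using kakeya_set_hausdorff_measure_nonzero[OF assms(1,2,4), of s] by force
    then show "of_nat CARD('n) \<le> z"
      unfolding s(1) by (simp add: ennreal_of_nat_eq_real_of_nat ennreal_leI)
  qed
qed

end
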